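(* The quantum chiral Minkowski superspace $\mathbb{C}_q[\mathbb{M}]$ is isomorphic to the quantum superalgebra of matrices $\mathrm{M}_q(2|2)$.
   Context: $\mathbb{C}_q=\mathbb{C}[q,q^{-1}]$. The quantum matrix superalgebra $\mathrm{M}_q(2|2)$ is the quotient of the free $\mathbb{C}_q$-superalgebra on generators $a_{ij}$, $1\le i,j\le4$, where $p(1)=p(2)=0$, $p(3)=p(4)=1$, $a_{ij}$ has parity $\pi(a_{ij})=p(i)+p(j)\bmod2$, even generators $a_{ij}$ being denoted $z_{ij}$ and odd ones $\xi_{ij}$, by the relations $\xi_{ij}^2=0$ and the Manin relations $$a_{ij}a_{il}=(-1)^{\pi(a_{ij})\pi(a_{il})}q^{(-1)^{p(i)+1}}a_{il}a_{ij}\quad (j<l),$$ $$a_{ij}a_{kj}=(-1)^{\pi(a_{ij})\pi(a_{kj})}q^{(-1)^{p(j)+1}}a_{kj}a_{ij}\quad (i<k),$$ $$a_{ij}a_{kl}=(-1)^{\pi(a_{ij})\pi(a_{kl})}a_{kl}a_{ij}\quad (i<k,\ j>l\ \text{ or }\ i>k,\ j<l),$$ $$a_{ij}a_{kl}-(-1)^{\pi(a_{ij})\pi(a_{kl})}a_{kl}a_{ij}=(-1)^{\pi(a_{ij})\pi(a_{kl})}(q^{-1}-q)a_{kj}a_{il}\quad (i<k,\ j<l).$$ $\mathbb{C}_q[S]$ is the $\mathbb{C}_q$-superalgebra generated by even $a_{ij}$ ($1\le i\le4$, $j=1,2$) and odd $a_{kl}=\alpha_{kl}$ ($k=5,6$,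 $l=1,2$) together with an inverse of $D_{12}$, subject to $\alpha_{kl}^2=0$ and the same four families of Manin relations, now with row parities $p(i)=0$ for $i\le4$, $p(5)=p(6)=1$, and both columns $1,2$ of parity $0$. Here $$D_{rs}=a_{r1}a_{s2}-q^{-1}a_{r2}a_{s1},\qquad 1\le r<s\le6 .$$ The $N=2$ quantum chiral Minkowski superspace $\mathbb{C}_q[\mathbb{M}]$ is the superalgebra generated, inside $\mathbb{C}_q[S]$, by the elements $$\tilde u_{i1}=-q^{-1}D_{2i}D_{12}^{-1},\quad \tilde u_{i2}=D_{1i}D_{12}^{-1}\ (i=3,4),\qquad \tilde\nu_{k1}=-q^{-1}D_{2k}D_{12}^{-1},\quad \tilde\nu_{k2}=D_{1k}D_{12}^{-1}\ (k=5,6).$$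
   Formalization: M_q(2|2) is replaced by its sub-superalgebra generated by a_ij with 1≤i≤4, j=1,2; with all 16 generators the claim fails, since C_q[M] is generated by 8 elements while M_q(2|2) at q=1 needs 16. *)

theory Defs
  imports
    Complex_Main
    "HOL-Library.Poly_Mapping"
    "HOL-Library.Z2"
    "HOL-Algebra.QuotRing"
    "HOL-Algebra.Module"
begin

section \<open>The ground ring and free superalgebras\<close>

text \<open>Laurent polynomials over the complex numbers: the group algebra of the additive group
  of integers, with the convolution product of \<^theory>\<open>HOL-Library.Poly_Mapping\<close>.\<close>

type_synonym laurent = "int \<Rightarrow>\<^sub>0 complex"

definition qvar :: laurent where "qvar = Poly_Mapping.single 1 1"

definition qinv :: laurent where "qinv = Poly_Mapping.single (- 1) 1"

lemma qvar_qinv: "qvar * qinv = 1"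
  by (simp add: qvar_def qinv_def mult_single)

text \<open>The free monoid, written additively because the product of \<^theory>\<open>HOL-Library.Poly_Mapping\<close>
  convolves along \<open>+\<close>; then \<open>'g fword \<Rightarrow>\<^sub>0 laurent\<close> is the free associative algebra on \<open>'g\<close>.\<close>

datatype 'g fword = Word (letters: "'g list")

instantiation fword :: (type) monoid_add
begin

definition zero_fword :: "'a fword" where "0 = Word []"

definition plus_fword :: "'a fword \<Rightarrow> 'a fword \<Rightarrow> 'a fword" where
  "v + w = Word (letters v @ letters w)"

instance
  by standard (simp_all add: zero_fword_def plus_fword_def)

end

type_synonym 'g falg = "'g fword \<Rightarrow>\<^sub>0 laurent"

definition var :: "'g \<Rightarrow> 'g falg" where
  "var g = Poly_Mapping.single (Word [g]) 1"

definition scal :: "laurent \<Rightarrow> 'g falg" where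
  "scal c = Poly_Mapping.single 0 c"

text \<open>\<open>homog A d\<close> is the homogeneous component of parity \<open>d\<close>.\<close>

record 'b salgebra = "(laurent, 'b) module" +
  homog :: "bit \<Rightarrow> 'b set"

definition free_salgebra :: "'g set \<Rightarrow> ('g \<Rightarrow> bit) \<Rightarrow> 'g falg salgebra" where
  "free_salgebra X \<pi> =
    \<lparr>carrier = {f. \<forall>w \<in> Poly_Mapping.keys f. set (letters w) \<subseteq> X},
     mult = (*), one = 1, zero = 0, add = (+),
     smult = (\<lambda>c f. scal c * f),
     homog = (\<lambda>d. {f. \<forall>w \<in> Poly_Mapping.keys f.
                set (letters w) \<subseteq> X \<and> (\<Sum>g\<leftarrow>letters w. \<pi> g) = d})\<rparr>"

text \<open>In particular the two-sided ideals \<open>Idl\<close> used below are taken in a genuine ring.\<close>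

lemma ring_free_salgebra: "ring (free_salgebra X \<pi>)"
proof -
  let ?C = "{f :: 'a falg. \<forall>w \<in> Poly_Mapping.keys f. set (letters w) \<subseteq> X}"
  have add: "f + g \<in> ?C" if "f \<in> ?C" "g \<in> ?C" for f g
    using that Poly_Mapping.keys_add[of f g] by blast
  have mult: "f * g \<in> ?C" if f: "f \<in> ?C" and g: "g \<in> ?C" for f g
  proof -
    have "set (letters w) \<subseteq> X" if "w \<in> Poly_Mapping.keys (f * g)" for w
    proof -
      from that keys_mult[of f g] obtain v v' where
        "w = v + v'" "v \<in> Poly_Mapping.keys f" "v' \<in> Poly_Mapping.keys g" by blast
      with f g show ?thesis by (simp add: plus_fword_def)
    qed
    then show ?thesis by blast
  qed
  have neg: "- f \<in> ?C" if "f \<in> ?C" for f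
    using that by simp
  have zero: "0 \<in> ?C" by simp
  have one: "1 \<in> ?C"
    by (simp add: zero_fword_def)
  have ab: "abelian_group (free_salgebra X \<pi>)"
  proof (rule abelian_groupI)
    fix x assume "x \<in> carrier (free_salgebra X \<pi>)"
    then have "- x \<in> ?C" using neg by (simp only: free_salgebra_def partial_object.simps)
    moreover have "- x + x = 0" by simp
    ultimately show "\<exists>y \<in> carrier (free_salgebra X \<pi>).
        y \<oplus>\<^bsub>free_salgebra X \<pi>\<^esub> x = \<zero>\<^bsub>free_salgebra X \<pi>\<^esub>"
      unfolding free_salgebra_def partial_object.simps ring.simps by (rule bexI[rotated])
  qed (use add zero in \<open>simp_all only: free_salgebra_def partial_object.simps ring.simps
          add.assoc add.left_neutral\<close>, simp_all only: add.commute)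
  have "Group.monoid (free_salgebra X \<pi>)"
    by (rule Group.monoidI) (use mult one in \<open>simp_all only: free_salgebra_def
          partial_object.simps monoid.simps mult.assoc mult_1_left mult_1_right\<close>)
  with ab show ?thesis
    by (rule ringI) (simp_all only: free_salgebra_def monoid.simps ring.simps
        distrib_left distrib_right)
qed


section \<open>Quotients, generated subalgebras and isomorphisms of superalgebras\<close>

definition quot_salgebra :: "'b salgebra \<Rightarrow> 'b set \<Rightarrow> 'b set salgebra" where
  "quot_salgebra A I =
    \<lparr>carrier = carrier (A Quot I), mult = mult (A Quot I), one = one (A Quot I),
     zero = zero (A Quot I), add = add (A Quot I),
     smult = (\<lambda>c K. \<Union>x\<in>K. I +>\<^bsub>A\<^esub> (c \<odot>\<^bsub>A\<^esub> x)),
     homog = (\<lambda>d. (\<lambda>x. I +>\<^bsub>A\<^esub> x) ` homog A d)\<rparr>"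

definition presented :: "'g set \<Rightarrow> ('g \<Rightarrow> bit) \<Rightarrow> 'g falg set \<Rightarrow> 'g falg set salgebra" where
  "presented X \<pi> R = quot_salgebra (free_salgebra X \<pi>) (Idl\<^bsub>free_salgebra X \<pi>\<^esub> R)"

definition presented_class ::
    "'g set \<Rightarrow> ('g \<Rightarrow> bit) \<Rightarrow> 'g falg set \<Rightarrow> 'g falg \<Rightarrow> 'g falg set" where
  "presented_class X \<pi> R f =
    (Idl\<^bsub>free_salgebra X \<pi>\<^esub> R) +>\<^bsub>free_salgebra X \<pi>\<^esub> f"

inductive_set gen_span :: "'b salgebra \<Rightarrow> 'b set \<Rightarrow> 'b set"
  for A :: "'b salgebra" and G :: "'b set"
where
  gen: "x \<in> G \<Longrightarrow> x \<in> gen_span A G"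
| one: "\<one>\<^bsub>A\<^esub> \<in> gen_span A G"
| smult: "x \<in> gen_span A G \<Longrightarrow> c \<odot>\<^bsub>A\<^esub> x \<in> gen_span A G"
| add: "x \<in> gen_span A G \<Longrightarrow> y \<in> gen_span A G \<Longrightarrow> x \<oplus>\<^bsub>A\<^esub> y \<in> gen_span A G"
| mult: "x \<in> gen_span A G \<Longrightarrow> y \<in> gen_span A G \<Longrightarrow> x \<otimes>\<^bsub>A\<^esub> y \<in> gen_span A G"

text \<open>Only applied to homogeneous generators, so that the intersections with the
  homogeneous components do grade the subalgebra.\<close>

definition sub_salgebra :: "'b salgebra \<Rightarrow> 'b set \<Rightarrow> 'b salgebra" where
  "sub_salgebra A G =
    A\<lparr>carrier := gen_span A G, homog := (\<lambda>d. homog A d \<inter> gen_span A G)\<rparr>"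

definition salgebra_iso :: "'b salgebra \<Rightarrow> 'c salgebra \<Rightarrow> ('b \<Rightarrow> 'c) set" where
  "salgebra_iso A B = {h \<in> ring_iso A B.
     (\<forall>c. \<forall>x \<in> carrier A. h (c \<odot>\<^bsub>A\<^esub> x) = c \<odot>\<^bsub>B\<^esub> h x) \<and>
     (\<forall>d. h ` homog A d = homog B d)}"

definition salgebra_isomorphic :: "'b salgebra \<Rightarrow> 'c salgebra \<Rightarrow> bool" where
  "salgebra_isomorphic A B \<longleftrightarrow> salgebra_iso A B \<noteq> {}"


section \<open>Manin relations\<close>

text \<open>\<open>Entry i j\<close> is the matrix generator \<open>a\<^sub>i\<^sub>j\<close>; \<open>Dinv\<close> is the extra generator of \<open>\<complex>\<^sub>q[S]\<close>
  that is made inverse to \<open>D\<^sub>1\<^sub>2\<close>.\<close>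

datatype gen = Entry nat nat | Dinv

abbreviation ent :: "nat \<Rightarrow> nat \<Rightarrow> gen falg" where
  "ent i j \<equiv> var (Entry i j)"

definition entry_parity :: "(nat \<Rightarrow> bit) \<Rightarrow> (nat \<Rightarrow> bit) \<Rightarrow> nat \<Rightarrow> nat \<Rightarrow> bit" where
  "entry_parity pr pc i j = pr i + pc j"

fun gen_parity :: "(nat \<Rightarrow> bit) \<Rightarrow> (nat \<Rightarrow> bit) \<Rightarrow> gen \<Rightarrow> bit" where
  "gen_parity pr pc (Entry i j) = entry_parity pr pc i j"
| "gen_parity pr pc Dinv = 0"

text \<open>The sign \<open>(-1)\<^bsup>s t\<^esup>\<close> and the power of \<open>q\<close> with exponent \<open>(-1)\<^bsup>s+1\<^esup>\<close>.\<close>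

definition koszul :: "bit \<Rightarrow> bit \<Rightarrow> laurent" where
  "koszul s t = (if s = 1 \<and> t = 1 then - 1 else 1)"

definition q_par :: "bit \<Rightarrow> laurent" where
  "q_par s = (if s = 0 then qinv else qvar)"

text \<open>Relations of a quantum supermatrix with rows \<open>I\<close>, columns \<open>J\<close> and row and column parities
  \<open>pr\<close>, \<open>pc\<close>. Each relation \<open>l = r\<close> is recorded as the element \<open>l - r\<close>.\<close>

definition manin_relations ::
    "nat set \<Rightarrow> nat set \<Rightarrow> (nat \<Rightarrow> bit) \<Rightarrow> (nat \<Rightarrow> bit) \<Rightarrow> gen falg set" where
  "manin_relations I J pr pc = (let p = entry_parity pr pc in
     {ent i j * ent i j | i j. i \<in> I \<and> j \<in> J \<and> p i j = 1} \<union>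
     {ent i j * ent i l - scal (koszul (p i j) (p i l) * q_par (pr i)) * (ent i l * ent i j)
        | i j l. i \<in> I \<and> j \<in> J \<and> l \<in> J \<and> j < l} \<union>
     {ent i j * ent k j - scal (koszul (p i j) (p k j) * q_par (pc j)) * (ent k j * ent i j)
        | i k j. i \<in> I \<and> k \<in> I \<and> j \<in> J \<and> i < k} \<union>
     {ent i j * ent k l - scal (koszul (p i j) (p k l)) * (ent k l * ent i j)
        | i j k l. i \<in> I \<and> k \<in> I \<and> j \<in> J \<and> l \<in> J \<and> (i < k \<and> j > l \<or> i > k \<and> j < l)} \<union>
     {ent i j * ent k l - scal (koszul (p i j) (p k l)) * (ent k l * ent i j)
        - scal (koszul (p i j) (p k l) * (qinv - qvar)) * (ent k j * ent i l)
        | i j k l. i \<in> I \<and> k \<in> I \<and> j \<in> J \<and> l \<in> J \<and> i < k \<and> j < l})"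


section \<open>The quantum matrix superalgebra\<close>

definition matrix_parity :: "nat \<Rightarrow> bit" where
  "matrix_parity i = (if i \<le> 2 then 0 else 1)"

definition Mq22_gens :: "gen set" where
  "Mq22_gens = {Entry i j | i j. i \<in> {1..4} \<and> j \<in> {1..4}}"

definition Mq22_rels :: "gen falg set" where
  "Mq22_rels = manin_relations {1..4} {1..4} matrix_parity matrix_parity"

definition Mq22 :: "gen falg set salgebra" where
  "Mq22 = presented Mq22_gens (gen_parity matrix_parity matrix_parity) Mq22_rels"

definition Mq22_class :: "gen falg \<Rightarrow> gen falg set" where
  "Mq22_class = presented_class Mq22_gens (gen_parity matrix_parity matrix_parity) Mq22_rels"

text \<open>
  The chiral Minkowski superspace corresponds to quantum \<open>(2|2) \<times> 2\<close> matrices, that is, to the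
  part of \<^const>\<open>Mq22\<close> on the two even columns, which has four even and four odd generators.
  It cannot be isomorphic to \<^const>\<open>Mq22\<close> with all of its sixteen entries: the chiral
  Minkowski superspace is generated by eight elements, whereas \<^const>\<open>Mq22\<close> becomes for \<open>q = 1\<close>
  the free supercommutative algebra on \<open>8|8\<close> generators, whose augmentation ideal \<open>m\<close> satisfies
  \<open>dim m / m\<^sup>2 = 16\<close>, so that it needs sixteen.

  The inclusion of the two columns is split by sending columns 3 and 4 to zero, so the subalgebra
  below is also the superalgebra presented by \<open>a\<^sub>i\<^sub>j\<close>, \<open>1 \<le> i \<le> 4\<close>, \<open>j = 1, 2\<close>, and the Manin
  relations among these generators.
\<close>

definition Mq22_even_columns :: "gen falg set salgebra" where
  "Mq22_even_columns =
    sub_salgebra Mq22 {Mq22_class (ent i j) | i j. i \<in> {1..4} \<and> j \<in> {1, 2}}"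


section \<open>The quantum chiral Minkowski superspace\<close>

definition S_row_parity :: "nat \<Rightarrow> bit" where
  "S_row_parity i = (if i \<le> 4 then 0 else 1)"

definition S_parity :: "gen \<Rightarrow> bit" where
  "S_parity = gen_parity S_row_parity (\<lambda>_. 0)"

text \<open>The minors \<open>D\<^sub>r\<^sub>s\<close>, as elements of the free algebra.\<close>

definition minor :: "nat \<Rightarrow> nat \<Rightarrow> gen falg" where
  "minor r s = ent r 1 * ent s 2 - scal qinv * (ent r 2 * ent s 1)"

definition S_gens :: "gen set" where
  "S_gens = {Entry i j | i j. i \<in> {1..6} \<and> j \<in> {1, 2}} \<union> {Dinv}"

definition S_rels :: "gen falg set" where
  "S_rels = manin_relations {1..6} {1, 2} S_row_parity (\<lambda>_. 0) \<union>
     {minor 1 2 * var Dinv - 1, var Dinv * minor 1 2 - 1}"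

definition Cq_S :: "gen falg set salgebra" where
  "Cq_S = presented S_gens S_parity S_rels"

definition S_class :: "gen falg \<Rightarrow> gen falg set" where
  "S_class = presented_class S_gens S_parity S_rels"

text \<open>The generators \<open>u\<^sub>i\<^sub>1, u\<^sub>i\<^sub>2\<close> (\<open>i = 3, 4\<close>) and \<open>\<nu>\<^sub>k\<^sub>1, \<nu>\<^sub>k\<^sub>2\<close> (\<open>k = 5, 6\<close>) are given by the
  same formulas.\<close>

definition mink_gen :: "nat \<Rightarrow> nat \<Rightarrow> gen falg set" where
  "mink_gen i j = S_class (if j = 1 then scal (- qinv) * (minor 2 i * var Dinv)
                         else minor 1 i * var Dinv)"

definition Cq_M :: "gen falg set salgebra" where
  "Cq_M = sub_salgebra Cq_S {mink_gen i j | i j. i \<in> {3..6} \<and> j \<in> {1, 2}}"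

end

theory Submission
  imports Defs "HOL-Library.Product_Plus"
begin

text \<open>
  The isomorphism exchanges the columns: \<open>t\<^sub>i\<^sub>1 = D\<^sub>1\<^sub>,\<^sub>i\<^sub>+\<^sub>2 D\<^sub>1\<^sub>2\<^sup>-\<^sup>1\<close> and
  \<open>t\<^sub>i\<^sub>2 = - q\<^sup>-\<^sup>1 D\<^sub>2\<^sub>,\<^sub>i\<^sub>+\<^sub>2 D\<^sub>1\<^sub>2\<^sup>-\<^sup>1\<close> satisfy the Manin relations of the first two columns of
  \<open>M\<^sub>q(2|2)\<close>, which is a normal ordering computation for \<open>2 \<times> 2\<close> minors.

  For injectivity, \<open>\<complex>\<^sub>q[S]\<close> is represented by operators on the two-column algebra \<open>P\<close> so that each
  generator of the superspace acts as left multiplication by the matching \<open>t\<^sub>i\<^sub>j\<close>, which is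
  faithful on \<open>P\<close>. Putting \<open>a\<^sub>1\<^sub>2 = 0\<close> forces the remaining matrix entries to be
  \<open>a\<^sub>i\<^sub>+\<^sub>2\<^sub>,\<^sub>1 = t\<^sub>i\<^sub>2 a\<^sub>1\<^sub>1 + t\<^sub>i\<^sub>1 a\<^sub>2\<^sub>1\<close> and \<open>a\<^sub>i\<^sub>+\<^sub>2\<^sub>,\<^sub>2 = t\<^sub>i\<^sub>1 a\<^sub>2\<^sub>2\<close>, and the Manin relations then force \<open>a\<^sub>1\<^sub>1\<close>
  and \<open>a\<^sub>2\<^sub>2\<close> to rescale the second and the first column by \<open>q\<^sup>-\<^sup>1\<close>, and \<open>a\<^sub>2\<^sub>1\<close> to be the skew
  derivation with \<open>a\<^sub>2\<^sub>1 t\<^sub>i\<^sub>2 = t\<^sub>i\<^sub>2 a\<^sub>2\<^sub>1\<close> and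
  \<open>a\<^sub>2\<^sub>1 t\<^sub>i\<^sub>1 = q\<^sup>-\<^sup>1 t\<^sub>i\<^sub>1 a\<^sub>2\<^sub>1 + (q\<^sup>-\<^sup>1 - q) t\<^sub>i\<^sub>2 a\<^sub>1\<^sub>1\<close>. All three respect the relations of \<open>P\<close>.

  The ideals of relations are stable under the parity automorphism, so membership in a homogeneous
  component is membership of \<open>\<theta>(f) - (\<plusminus> f)\<close> in the ideal, and any isomorphism matching
  homogeneous generators is graded.
\<close>

section \<open>Evaluation of free algebras\<close>

definition free_carrier :: "'g set \<Rightarrow> 'g falg set" where
  "free_carrier X = {f. \<forall>w \<in> Poly_Mapping.keys f. set (letters w) \<subseteq> X}"

lemma falg_induct [case_names zero single add]:
  fixes f :: "'g falg"
  assumes "P 0" "\<And>w c. P (Poly_Mapping.single w c)" "\<And>f g. P f \<Longrightarrow> P g \<Longrightarrow> P (f + g)"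
  shows "P f"
proof -
  have f: "f = (\<Sum>w\<in>Poly_Mapping.keys f. Poly_Mapping.single w (Poly_Mapping.lookup f w))"
    by (rule poly_mapping_eqI) (simp add: lookup_sum lookup_single when_def in_keys_iff)
  have "P (\<Sum>w\<in>A. Poly_Mapping.single w (Poly_Mapping.lookup f w))" if "finite A" for A
    using that by (induction A) (auto intro: assms)
  from this[of "Poly_Mapping.keys f"] f show ?thesis by simp
qed

lemma carrier_free_salgebra: "carrier (free_salgebra X \<pi>) = free_carrier X"
  by (simp add: free_salgebra_def free_carrier_def)

lemma free_carrier_closed [intro, simp]:
  fixes f g :: "'g falg"
  shows "f \<in> free_carrier X \<Longrightarrow> g \<in> free_carrier X \<Longrightarrow> f + g \<in> free_carrier X"
    and "f \<in> free_carrier X \<Longrightarrow> g \<in> free_carrier X \<Longrightarrow> f * g \<in> free_carrier X"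
    and "f \<in> free_carrier X \<Longrightarrow> g \<in> free_carrier X \<Longrightarrow> f - g \<in> free_carrier X"
    and "f \<in> free_carrier X \<Longrightarrow> - f \<in> free_carrier X"
    and "scal c \<in> free_carrier X" and "0 \<in> free_carrier X" and "1 \<in> free_carrier X"
    and "x \<in> X \<Longrightarrow> var x \<in> free_carrier X"
proof -
  show add: "f + g \<in> free_carrier X" if "f \<in> free_carrier X" "g \<in> free_carrier X" for f g :: "'g falg"
    using that Poly_Mapping.keys_add[of f g] unfolding free_carrier_def by blast
  show neg: "- f \<in> free_carrier X" if "f \<in> free_carrier X" for f :: "'g falg"
    using that by (simp add: free_carrier_def)
  show "f - g \<in> free_carrier X" if "f \<in> free_carrier X" "g \<in> free_carrier X" for f g :: "'g falg"
    using add[OF that(1) neg[OF that(2)]] by simp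
  show "f * g \<in> free_carrier X" if "f \<in> free_carrier X" "g \<in> free_carrier X"
    using ring.ring_simprules(5)[OF ring_free_salgebra[of X undefined], of f g] that
    by (simp add: carrier_free_salgebra) (simp add: free_salgebra_def)
qed (simp_all add: free_carrier_def scal_def var_def zero_fword_def)

text \<open>A word is built by prepending letters, so closure under left multiplication by single
  generators takes the place of closure under all products.\<close>

lemma free_carrier_induct [consumes 1, case_names scal var add]:
  fixes f :: "'g falg"
  assumes f: "f \<in> free_carrier X"
    and sc: "\<And>c. P (scal c)"
    and var: "\<And>g f. g \<in> X \<Longrightarrow> f \<in> free_carrier X \<Longrightarrow> P f \<Longrightarrow> P (var g * f)"
    and add: "\<And>f g. f \<in> free_carrier X \<Longrightarrow> g \<in> free_carrier X \<Longrightarrow> P f \<Longrightarrow> P g \<Longrightarrow> P (f + g)"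
  shows "P f"
proof -
  have single: "P (Poly_Mapping.single (Word ws) c) \<and> Poly_Mapping.single (Word ws) c \<in> free_carrier X"
    if "set ws \<subseteq> X" for ws c
    using that
  proof (induction ws)
    case Nil
    then show ?case using sc[of c] free_carrier_closed(5)[of c X] by (simp add: scal_def zero_fword_def)
  next
    case (Cons g ws)
    have "Poly_Mapping.single (Word (g # ws)) c = var g * Poly_Mapping.single (Word ws) c"
      by (simp add: var_def mult_single plus_fword_def)
    with Cons var[of g "Poly_Mapping.single (Word ws) c"] show ?case by simp
  qed
  have f': "f = (\<Sum>w\<in>Poly_Mapping.keys f. Poly_Mapping.single w (Poly_Mapping.lookup f w))"
    by (rule poly_mapping_eqI) (simp add: lookup_sum lookup_single when_def in_keys_iff)
  have "P (\<Sum>w\<in>A. Poly_Mapping.single w (Poly_Mapping.lookup f w)) \<and>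
      (\<Sum>w\<in>A. Poly_Mapping.single w (Poly_Mapping.lookup f w)) \<in> free_carrier X"
    if "finite A" "A \<subseteq> Poly_Mapping.keys f" for A
    using that
  proof (induction A)
    case empty
    then show ?case using sc[of 0] by (simp add: scal_def)
  next
    case (insert w A)
    have "set (letters w) \<subseteq> X"
      using f insert.prems by (auto simp: free_carrier_def)
    with single[of "letters w"] have "P (Poly_Mapping.single w (Poly_Mapping.lookup f w)) \<and>
        Poly_Mapping.single w (Poly_Mapping.lookup f w) \<in> free_carrier X"
      by simp
    with insert show ?case
      by (simp add: add)
  qed
  from this[of "Poly_Mapping.keys f"] f' show ?thesis by simp
qed

lemma scal_add: "scal (c + d) = scal c + scal d"
  by (simp add: scal_def single_add)

lemma scal_mult: "scal (c * d) = scal c * scal d"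
  by (simp add: scal_def mult_single)

lemma scal_0 [simp]: "scal 0 = 0"
  by (simp add: scal_def)

lemma scal_1 [simp]: "scal 1 = 1"
  by (simp add: scal_def)

lemma scal_uminus: "scal (- c) = - scal c"
  by (simp add: scal_def single_uminus)

lemma scal_central: "scal c * f = f * scal c"
proof (induction f rule: falg_induct)
  case (single w d)
  then show ?case by (simp add: scal_def mult_single mult.commute)
qed (simp_all add: distrib_left distrib_right)

text \<open>The target is only assumed to be in \<open>{ring, monoid_mult}\<close>: \<open>ring_1\<close> would require \<open>0 \<noteq> 1\<close>,
  which is not known in advance for a ring given by generators and relations.\<close>

definition eval :: "(laurent \<Rightarrow> 'r::{ring,monoid_mult}) \<Rightarrow> ('g \<Rightarrow> 'r) \<Rightarrow> 'g falg \<Rightarrow> 'r" where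
  "eval \<iota> v f = (\<Sum>w\<in>Poly_Mapping.keys f. \<iota> (Poly_Mapping.lookup f w) * prod_list (map v (letters w)))"

text \<open>The universal property of the free algebra over \<open>laurent\<close>. Scalars have to
  commute with the images of the generators but need not be central, which admits rings of operators
  as targets.\<close>

locale falg_hom =
  fixes \<iota> :: "laurent \<Rightarrow> 'r::{ring,monoid_mult}" and v :: "'g \<Rightarrow> 'r"
  assumes scalar_add: "\<iota> (c + d) = \<iota> c + \<iota> d"
    and scalar_mult: "\<iota> (c * d) = \<iota> c * \<iota> d"
    and scalar_one: "\<iota> 1 = 1"
    and scalar_commute: "\<iota> c * v g = v g * \<iota> c"
begin

lemma scalar_zero: "\<iota> 0 = 0"
  using scalar_add[of 0 0] by simp

lemma scalar_uminus: "\<iota> (- c) = - \<iota> c"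
  using scalar_add[of c "- c"] by (simp add: scalar_zero eq_neg_iff_add_eq_0 add.commute)

lemma scalar_diff: "\<iota> (c - d) = \<iota> c - \<iota> d"
  using scalar_add[of c "- d"] by (simp add: scalar_uminus)

lemma scalar_commute_prod: "\<iota> c * prod_list (map v ws) = prod_list (map v ws) * \<iota> c"
proof (induction ws)
  case (Cons g ws)
  then show ?case
    by (metis list.simps(9) mult.assoc prod_list.Cons scalar_commute)
qed simp

lemma eval_superset:
  "finite A \<Longrightarrow> Poly_Mapping.keys f \<subseteq> A \<Longrightarrow>
    eval \<iota> v f = (\<Sum>w\<in>A. \<iota> (Poly_Mapping.lookup f w) * prod_list (map v (letters w)))"
  unfolding eval_def by (rule sum.mono_neutral_left) (auto simp: in_keys_iff scalar_zero)

lemma eval_0 [simp]: "eval \<iota> v 0 = 0"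
  by (simp add: eval_def)

lemma eval_single: "eval \<iota> v (Poly_Mapping.single w c) = \<iota> c * prod_list (map v (letters w))"
  by (simp add: eval_superset[of "{w}"])

lemma eval_add: "eval \<iota> v (f + g) = eval \<iota> v f + eval \<iota> v g"
proof -
  let ?A = "Poly_Mapping.keys f \<union> Poly_Mapping.keys g"
  show ?thesis
    using Poly_Mapping.keys_add[of f g]
    by (simp add: eval_superset[of ?A] lookup_add scalar_add distrib_right sum.distrib)
qed

lemma eval_uminus: "eval \<iota> v (- f) = - eval \<iota> v f"
  using eval_add[of f "- f"] by (simp add: eq_neg_iff_add_eq_0 add.commute)

lemma eval_diff: "eval \<iota> v (f - g) = eval \<iota> v f - eval \<iota> v g"
  using eval_add[of f "- g"] by (simp add: eval_uminus)

lemma eval_mult: "eval \<iota> v (f * g) = eval \<iota> v f * eval \<iota> v g"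
proof (induction f rule: falg_induct)
  case (single w c)
  show ?case
  proof (induction g rule: falg_induct)
    case (single w' d)
    \<comment> \<open>The product of two monomials leaves the second scalar behind the first word;
      it is moved past that word.\<close>
    have "\<iota> c * \<iota> d * (prod_list (map v (letters w)) * p) = \<iota> c * prod_list (map v (letters w)) * (\<iota> d * p)" for p
      by (metis mult.assoc scalar_commute_prod)
    then show ?case by (simp add: mult_single eval_single scalar_mult plus_fword_def)
  qed (simp_all add: eval_add distrib_left)
qed (simp_all add: eval_add distrib_right)

lemma eval_scal [simp]: "eval \<iota> v (scal c) = \<iota> c"
  by (simp add: scal_def eval_single zero_fword_def)

lemma eval_var [simp]: "eval \<iota> v (var g) = v g"
  by (simp add: var_def eval_single scalar_one)

lemma eval_1 [simp]: "eval \<iota> v 1 = 1"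
  using eval_scal[of 1] by (simp add: scalar_one)

lemmas eval_simps = eval_add eval_diff eval_uminus eval_mult

lemma hom_unique:
  assumes "f \<in> free_carrier X"
    and "\<And>f g. \<phi> (f + g) = \<phi> f + \<phi> g" "\<And>f g. \<phi> (f * g) = \<phi> f * \<phi> g"
    and "\<And>c. \<phi> (scal c) = \<iota> c" "\<And>g. g \<in> X \<Longrightarrow> \<phi> (var g) = v g"
  shows "\<phi> f = eval \<iota> v f"
  using assms(1) by (induction f rule: free_carrier_induct) (simp_all add: assms(2-) eval_simps)

end

section \<open>Substitution homomorphisms between free algebras\<close>

lemma falg_hom_scal: "falg_hom scal (v :: 'g \<Rightarrow> 'h falg)"
  by standard (simp_all only: scal_add scal_mult scal_1 scal_central[of _ "v _"])

definition subst :: "('g \<Rightarrow> 'h falg) \<Rightarrow> 'g falg \<Rightarrow> 'h falg" where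
  "subst = eval scal"

lemmas subst_add = falg_hom.eval_add[OF falg_hom_scal, folded subst_def]
  and subst_diff = falg_hom.eval_diff[OF falg_hom_scal, folded subst_def]
  and subst_uminus = falg_hom.eval_uminus[OF falg_hom_scal, folded subst_def]
  and subst_mult = falg_hom.eval_mult[OF falg_hom_scal, folded subst_def]
  and subst_scal [simp] = falg_hom.eval_scal[OF falg_hom_scal, folded subst_def]
  and subst_var [simp] = falg_hom.eval_var[OF falg_hom_scal, folded subst_def]
  and subst_0 [simp] = falg_hom.eval_0[OF falg_hom_scal, folded subst_def]
  and subst_1 [simp] = falg_hom.eval_1[OF falg_hom_scal, folded subst_def]
  and hom_unique_subst = falg_hom.hom_unique[OF falg_hom_scal, folded subst_def]

lemmas subst_simps = subst_add subst_diff subst_uminus subst_mult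

lemma subst_closed:
  assumes "f \<in> free_carrier X" "\<And>g. g \<in> X \<Longrightarrow> v g \<in> free_carrier Y"
  shows "subst v f \<in> free_carrier Y"
  using assms(1)
proof (induction f rule: free_carrier_induct)
  case (scal c)
  then show ?case by simp
next
  case (var g f)
  then show ?case by (simp add: subst_mult assms(2))
next
  case (add f g)
  then show ?case by (simp add: subst_add)
qed

lemma subst_ident:
  assumes "f \<in> free_carrier X" "\<And>g. g \<in> X \<Longrightarrow> v g = var g"
  shows "subst v f = f"
  using hom_unique_subst[OF assms(1), of "\<lambda>f. f" v, symmetric] assms(2) by simp

lemma eval_subst:
  assumes "falg_hom \<iota> v" "falg_hom \<iota> v'" "f \<in> free_carrier X"
    "\<And>g. g \<in> X \<Longrightarrow> eval \<iota> v (s g) = v' g"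
  shows "eval \<iota> v (subst s f) = eval \<iota> v' f"
  by (rule falg_hom.hom_unique[OF assms(2) assms(3), where \<phi> = "\<lambda>f. eval \<iota> v (subst s f)"])
    (simp_all add: subst_simps falg_hom.eval_simps[OF assms(1)] falg_hom.eval_scal[OF assms(1)] assms(4))

lemma subst_subst:
  assumes "f \<in> free_carrier X" "\<And>g. g \<in> X \<Longrightarrow> subst v (s g) = v' g"
  shows "subst v (subst s f) = subst v' f"
  using eval_subst[OF falg_hom_scal falg_hom_scal assms(1), of v s v'] assms(2)
  unfolding subst_def by blast

section \<open>Ideals, presentations and gradings\<close>

definition two_sided :: "'g set \<Rightarrow> 'g falg set \<Rightarrow> bool" where
  "two_sided X J \<longleftrightarrow> J \<subseteq> free_carrier X \<and> 0 \<in> J \<and> (\<forall>f\<in>J. \<forall>g\<in>J. f + g \<in> J) \<and>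
    (\<forall>f\<in>J. \<forall>g\<in>free_carrier X. g * f \<in> J \<and> f * g \<in> J)"

lemma two_sidedD:
  assumes "two_sided X J"
  shows "f \<in> J \<Longrightarrow> f \<in> free_carrier X" "0 \<in> J" "f \<in> J \<Longrightarrow> g \<in> J \<Longrightarrow> f + g \<in> J"
    "f \<in> J \<Longrightarrow> g \<in> free_carrier X \<Longrightarrow> g * f \<in> J"
    "f \<in> J \<Longrightarrow> g \<in> free_carrier X \<Longrightarrow> f * g \<in> J"
    "f \<in> J \<Longrightarrow> - f \<in> J" "f \<in> J \<Longrightarrow> g \<in> J \<Longrightarrow> f - g \<in> J"
    "f \<in> J \<Longrightarrow> scal c * f \<in> J"
proof -
  show neg: "- f \<in> J" if "f \<in> J" for f
  proof -
    have "- 1 * f \<in> J"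
      using assms that unfolding two_sided_def by (meson free_carrier_closed(4,7))
    then show ?thesis by simp
  qed
  show "f - g \<in> J" if "f \<in> J" "g \<in> J"
    using assms that(1) neg[OF that(2)] unfolding two_sided_def by (metis diff_conv_add_uminus)
qed (use assms in \<open>auto simp: two_sided_def\<close>)

text \<open>Bridge from ideals of record-based rings to plain closure conditions in the type
  \<open>'g falg\<close>.\<close>

lemma ideal_free_salgebra_iff: "ideal J (free_salgebra X \<pi>) \<longleftrightarrow> two_sided X J"
proof
  interpret F: ring "free_salgebra X \<pi>" by (rule ring_free_salgebra)
  assume "ideal J (free_salgebra X \<pi>)"
  then interpret ideal J "free_salgebra X \<pi>" .
  show "two_sided X J"
    using a_subset additive_subgroup.zero_closed[OF is_additive_subgroup] a_closed I_l_closed I_r_closed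
    unfolding two_sided_def carrier_free_salgebra by (auto simp: free_salgebra_def free_carrier_def)
next
  assume J: "two_sided X J"
  interpret F: ring "free_salgebra X \<pi>" by (rule ring_free_salgebra)
  \<comment> \<open>The additive inverse of the record is a description; uniqueness of inverses
    identifies it with unary minus.\<close>
  have neg: "\<ominus>\<^bsub>free_salgebra X \<pi>\<^esub> f = - f" if "f \<in> free_carrier X" for f
    using that F.minus_equality[of "- f" f] free_carrier_closed(4)[OF that]
    unfolding carrier_free_salgebra by (simp add: free_salgebra_def)
  show "ideal J (free_salgebra X \<pi>)"
  proof (rule idealI)
    show "subgroup J (add_monoid (free_salgebra X \<pi>))"
    proof
      fix x assume "x \<in> J"
      then show "inv\<^bsub>add_monoid (free_salgebra X \<pi>)\<^esub> x \<in> J"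
        using neg[of x] two_sidedD(1,6)[OF J] by (simp add: a_inv_def)
    qed (use two_sidedD[OF J] in \<open>auto simp: free_salgebra_def free_carrier_def\<close>)
  qed (use two_sidedD(4,5)[OF J] in
      \<open>auto simp: ring_free_salgebra carrier_free_salgebra, auto simp: free_salgebra_def\<close>)
qed

context
  fixes X :: "'g set" and \<pi> :: "'g \<Rightarrow> bit" and R :: "'g falg set"
  assumes R: "R \<subseteq> free_carrier X"
begin

lemma two_sided_Idl: "two_sided X (Idl\<^bsub>free_salgebra X \<pi>\<^esub> R)"
  using ring.genideal_ideal[OF ring_free_salgebra, of R X \<pi>] R
  by (simp add: ideal_free_salgebra_iff carrier_free_salgebra)

lemma subset_Idl: "R \<subseteq> Idl\<^bsub>free_salgebra X \<pi>\<^esub> R"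
  using ring.genideal_self[OF ring_free_salgebra, of R X \<pi>] R by (simp add: carrier_free_salgebra)

lemma Idl_minimal: "two_sided X J \<Longrightarrow> R \<subseteq> J \<Longrightarrow> Idl\<^bsub>free_salgebra X \<pi>\<^esub> R \<subseteq> J"
  by (rule ring.genideal_minimal[OF ring_free_salgebra]) (simp_all add: ideal_free_salgebra_iff)

text \<open>The polynomials killed by \<open>eval \<iota> v\<close> form a two-sided ideal, and
  \<open>Idl\<close> is the smallest one containing \<open>R\<close>.\<close>

lemma eval_Idl:
  assumes hom: "falg_hom \<iota> v" and "\<And>r. r \<in> R \<Longrightarrow> eval \<iota> v r = 0"
    and "f \<in> Idl\<^bsub>free_salgebra X \<pi>\<^esub> R"
  shows "eval \<iota> v f = 0"
proof -
  interpret falg_hom \<iota> v by (rule hom)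
  have "two_sided X {f \<in> free_carrier X. eval \<iota> v f = 0}"
    by (auto simp: two_sided_def eval_simps)
  with Idl_minimal[OF this] assms R show ?thesis by blast
qed

lemma subst_Idl:
  assumes "two_sided Y J" and "\<And>g. g \<in> X \<Longrightarrow> s g \<in> free_carrier Y"
    and "\<And>r. r \<in> R \<Longrightarrow> subst s r \<in> J" and "f \<in> Idl\<^bsub>free_salgebra X \<pi>\<^esub> R"
  shows "subst s f \<in> J"
proof -
  have "two_sided X {f \<in> free_carrier X. subst s f \<in> J}"
    using two_sidedD[OF assms(1)] subst_closed[of _ X s Y] assms(2)
    by (auto simp: two_sided_def subst_simps)
  with Idl_minimal[OF this] assms R show ?thesis by blast
qed

section \<open>Classes, operations and generated subalgebras in a presented superalgebra\<close>

lemma presented_class_eq: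
  "presented_class X \<pi> R f = {i + f | i. i \<in> Idl\<^bsub>free_salgebra X \<pi>\<^esub> R}"
  by (auto simp: presented_class_def a_r_coset_def r_coset_def free_salgebra_def)

lemma presented_class_eq_iff:
  "presented_class X \<pi> R f = presented_class X \<pi> R g \<longleftrightarrow> f - g \<in> Idl\<^bsub>free_salgebra X \<pi>\<^esub> R"
proof
  let ?I = "Idl\<^bsub>free_salgebra X \<pi>\<^esub> R"
  assume "presented_class X \<pi> R f = presented_class X \<pi> R g"
  moreover have "f \<in> presented_class X \<pi> R f"
    using two_sidedD(2)[OF two_sided_Idl] unfolding presented_class_eq by force
  ultimately obtain i where "i \<in> ?I" "f = i + g" unfolding presented_class_eq by auto
  then show "f - g \<in> ?I" by simp
next
  let ?I = "Idl\<^bsub>free_salgebra X \<pi>\<^esub> R"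
  have sub: "presented_class X \<pi> R f \<subseteq> presented_class X \<pi> R g" if d: "f - g \<in> ?I" for f g
  proof
    fix x assume "x \<in> presented_class X \<pi> R f"
    then obtain i where i: "i \<in> ?I" "x = i + f" unfolding presented_class_eq by auto
    with d have "i + (f - g) \<in> ?I" "x = (i + (f - g)) + g"
      using two_sidedD(3)[OF two_sided_Idl] by simp_all
    then show "x \<in> presented_class X \<pi> R g" unfolding presented_class_eq by blast
  qed
  assume d: "f - g \<in> ?I"
  then have "g - f \<in> ?I" using two_sidedD(6)[OF two_sided_Idl d] by simp
  with sub d show "presented_class X \<pi> R f = presented_class X \<pi> R g" by blast
qed

lemma presented_simps:
  shows "carrier (presented X \<pi> R) = presented_class X \<pi> R ` free_carrier X"
    and "f \<in> free_carrier X \<Longrightarrow> g \<in> free_carrier X \<Longrightarrow>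
      presented_class X \<pi> R f \<otimes>\<^bsub>presented X \<pi> R\<^esub> presented_class X \<pi> R g = presented_class X \<pi> R (f * g)"
    and "f \<in> free_carrier X \<Longrightarrow> g \<in> free_carrier X \<Longrightarrow>
      presented_class X \<pi> R f \<oplus>\<^bsub>presented X \<pi> R\<^esub> presented_class X \<pi> R g = presented_class X \<pi> R (f + g)"
    and "\<one>\<^bsub>presented X \<pi> R\<^esub> = presented_class X \<pi> R 1"
    and "f \<in> free_carrier X \<Longrightarrow>
      c \<odot>\<^bsub>presented X \<pi> R\<^esub> presented_class X \<pi> R f = presented_class X \<pi> R (scal c * f)"
    and "homog (presented X \<pi> R) d = presented_class X \<pi> R ` homog (free_salgebra X \<pi>) d"
proof -
  let ?F = "free_salgebra X \<pi>" and ?I = "Idl\<^bsub>free_salgebra X \<pi>\<^esub> R"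
  interpret F: ideal ?I ?F by (simp add: ideal_free_salgebra_iff two_sided_Idl)
  have hom: "(+>\<^bsub>?F\<^esub>) ?I \<in> ring_hom ?F (?F Quot ?I)" by (rule F.rcos_ring_hom)
  note defs = presented_def quot_salgebra_def presented_class_def
  show "carrier (presented X \<pi> R) = presented_class X \<pi> R ` free_carrier X"
    by (auto simp: defs FactRing_def A_RCOSETS_defs a_r_coset_def carrier_free_salgebra)
  show "f \<in> free_carrier X \<Longrightarrow> g \<in> free_carrier X \<Longrightarrow>
      presented_class X \<pi> R f \<otimes>\<^bsub>presented X \<pi> R\<^esub> presented_class X \<pi> R g = presented_class X \<pi> R (f * g)"
    using ring_hom_mult[OF hom, of f g] unfolding carrier_free_salgebra
    by (simp add: defs) (simp add: free_salgebra_def)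
  show "f \<in> free_carrier X \<Longrightarrow> g \<in> free_carrier X \<Longrightarrow>
      presented_class X \<pi> R f \<oplus>\<^bsub>presented X \<pi> R\<^esub> presented_class X \<pi> R g = presented_class X \<pi> R (f + g)"
    using ring_hom_add[OF hom, of f g] unfolding carrier_free_salgebra
    by (simp add: defs) (simp add: free_salgebra_def)
  show "\<one>\<^bsub>presented X \<pi> R\<^esub> = presented_class X \<pi> R 1"
    using ring_hom_one[OF hom] by (simp add: defs) (simp add: free_salgebra_def)
  show "homog (presented X \<pi> R) d = presented_class X \<pi> R ` homog ?F d"
    by (simp add: defs)
  assume f: "f \<in> free_carrier X"
  have "c \<odot>\<^bsub>presented X \<pi> R\<^esub> presented_class X \<pi> R f =
      (\<Union>x\<in>presented_class X \<pi> R f. presented_class X \<pi> R (scal c * x))"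
    by (simp add: defs) (simp add: free_salgebra_def)
  \<comment> \<open>The scalar action on a coset is a union over all its representatives. They all
    contribute the same coset, because the ideal is stable under scalars.\<close>
  also have "\<dots> = (\<Union>x\<in>presented_class X \<pi> R f. presented_class X \<pi> R (scal c * f))"
  proof (rule SUP_cong)
    fix x assume "x \<in> presented_class X \<pi> R f"
    then have "x - f \<in> ?I" unfolding presented_class_eq by auto
    then have "scal c * (x - f) \<in> ?I" by (rule two_sidedD(8)[OF two_sided_Idl])
    then show "presented_class X \<pi> R (scal c * x) = presented_class X \<pi> R (scal c * f)"
      by (simp add: presented_class_eq_iff right_diff_distrib)
  qed simp
  also have "\<dots> = presented_class X \<pi> R (scal c * f)"
    using two_sidedD(2)[OF two_sided_Idl] unfolding presented_class_eq by blast
  finally show "c \<odot>\<^bsub>presented X \<pi> R\<^esub> presented_class X \<pi> R f = presented_class X \<pi> R (scal c * f)" .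
qed

text \<open>The elements of a generated subalgebra are classes of noncommutative polynomials in its
  generators, with \<open>Y\<close> as a set of names for them. Two subalgebras with the same names
  can then be compared polynomial by polynomial.\<close>

lemma gen_span_presented:
  assumes v: "\<And>g. g \<in> Y \<Longrightarrow> v g \<in> free_carrier X"
  shows "gen_span (presented X \<pi> R) ((\<lambda>g. presented_class X \<pi> R (v g)) ` Y) =
    (\<lambda>f. presented_class X \<pi> R (subst v f)) ` free_carrier Y" (is "?L = ?cl ` _")
proof -
  note closed = subst_closed[of _ Y v X, OF _ v]
  show ?thesis
  proof (intro equalityI subsetI)
    fix x assume "x \<in> ?L"
    then show "x \<in> ?cl ` free_carrier Y"
    proof induction
      case (gen x)
      then obtain g where "g \<in> Y" "x = ?cl (var g)" by auto
      then show ?case by blast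
    next
      case one
      have "\<one>\<^bsub>presented X \<pi> R\<^esub> = ?cl 1" by (simp add: presented_simps)
      then show ?case by blast
    next
      case (smult x c)
      then obtain f where "f \<in> free_carrier Y" "x = ?cl f" by blast
      then have "c \<odot>\<^bsub>presented X \<pi> R\<^esub> x = ?cl (scal c * f)" "scal c * f \<in> free_carrier Y"
        by (simp_all add: presented_simps closed subst_mult)
      then show ?case by blast
    next
      case (add x y)
      then obtain f g where "f \<in> free_carrier Y" "x = ?cl f" "g \<in> free_carrier Y" "y = ?cl g" by blast
      then have "x \<oplus>\<^bsub>presented X \<pi> R\<^esub> y = ?cl (f + g)" "f + g \<in> free_carrier Y"
        by (simp_all add: presented_simps closed subst_add)
      then show ?case by blast
    next
      case (mult x y)
      then obtain f g where "f \<in> free_carrier Y" "x = ?cl f" "g \<in> free_carrier Y" "y = ?cl g" by blast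
      then have "x \<otimes>\<^bsub>presented X \<pi> R\<^esub> y = ?cl (f * g)" "f * g \<in> free_carrier Y"
        by (simp_all add: presented_simps closed subst_mult)
      then show ?case by blast
    qed
  next
    fix x assume "x \<in> ?cl ` free_carrier Y"
    then obtain f where f: "f \<in> free_carrier Y" "x = ?cl f" by blast
    from f(1) have "?cl f \<in> ?L"
    proof (induction f rule: free_carrier_induct)
      case (scal c)
      have "?cl (scal c) = c \<odot>\<^bsub>presented X \<pi> R\<^esub> \<one>\<^bsub>presented X \<pi> R\<^esub>"
        by (simp add: presented_simps)
      then show ?case by (simp only: gen_span.one gen_span.smult)
    next
      case (var g f)
      then have "?cl (var g * f) = presented_class X \<pi> R (v g) \<otimes>\<^bsub>presented X \<pi> R\<^esub> ?cl f"
        by (simp add: presented_simps subst_mult v closed)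
      with var show ?case by (simp only:) (blast intro: gen_span.gen gen_span.mult)
    next
      case (add f g)
      then have "?cl (f + g) = ?cl f \<oplus>\<^bsub>presented X \<pi> R\<^esub> ?cl g"
        by (simp add: presented_simps subst_add closed)
      with add show ?case by (simp only: gen_span.add)
    qed
    with f show "x \<in> ?L" by simp
  qed
qed

end

section \<open>The parity involution and homogeneous components\<close>

definition parity_sign :: "bit \<Rightarrow> laurent" where
  "parity_sign d = (if d = 1 then - 1 else 1)"

lemma parity_sign_simps [simp]: "parity_sign 0 = 1" "parity_sign 1 = - 1"
    "parity_sign d * parity_sign d = 1"
  by (simp_all add: parity_sign_def)

lemma parity_sign_add: "parity_sign (d + e) = parity_sign d * parity_sign e"
  by (cases d; cases e) (simp_all add: parity_sign_def)

text \<open>The parity involution. It turns homogeneity, which is defined through words, into a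
  linear equation that passes to quotients.\<close>

definition parity_aut :: "('g \<Rightarrow> bit) \<Rightarrow> 'g falg \<Rightarrow> 'g falg" where
  "parity_aut \<pi> = subst (\<lambda>g. scal (parity_sign (\<pi> g)) * var g)"

lemma parity_aut_simps:
  "parity_aut \<pi> (f + g) = parity_aut \<pi> f + parity_aut \<pi> g"
  "parity_aut \<pi> (f - g) = parity_aut \<pi> f - parity_aut \<pi> g"
  "parity_aut \<pi> (f * g) = parity_aut \<pi> f * parity_aut \<pi> g"
  "parity_aut \<pi> (scal c) = scal c" "parity_aut \<pi> 1 = 1"
  "parity_aut \<pi> (var x) = scal (parity_sign (\<pi> x)) * var x"
  by (simp_all add: parity_aut_def subst_simps)

lemma lookup_parity_aut:
  "Poly_Mapping.lookup (parity_aut \<pi> f) w =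
    parity_sign (\<Sum>g\<leftarrow>letters w. \<pi> g) * Poly_Mapping.lookup f w"
proof (induction f rule: falg_induct)
  case (single u c)
  have prod: "prod_list (map (\<lambda>g. scal (parity_sign (\<pi> g)) * var g) ws) =
      Poly_Mapping.single (Word ws) (parity_sign (\<Sum>g\<leftarrow>ws. \<pi> g))" for ws
  proof (induction ws)
    case Nil
    show ?case by (simp flip: zero_fword_def)
  next
    case (Cons g ws)
    then have "prod_list (map (\<lambda>g. scal (parity_sign (\<pi> g)) * var g) (g # ws)) =
        Poly_Mapping.single (Word (g # ws)) (parity_sign (\<pi> g) * parity_sign (\<Sum>g\<leftarrow>ws. \<pi> g))"
      by (simp add: scal_def var_def mult_single zero_fword_def plus_fword_def)
    then show ?case by (simp only: list.map sum_list.Cons parity_sign_add)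
  qed
  have "parity_aut \<pi> (Poly_Mapping.single u c) =
      Poly_Mapping.single u (c * parity_sign (\<Sum>g\<leftarrow>letters u. \<pi> g))"
    unfolding parity_aut_def subst_def falg_hom.eval_single[OF falg_hom_scal] prod
    by (simp add: scal_def mult_single zero_fword_def plus_fword_def)
  then show ?case by (simp add: lookup_single when_def mult.commute)
qed (simp_all add: parity_aut_def subst_add lookup_add distrib_left)

lemma lookup_scal_mult: "Poly_Mapping.lookup (scal c * f) w = c * Poly_Mapping.lookup f w"
  by (induction f rule: falg_induct)
    (simp_all add: lookup_add distrib_left scal_def mult_single lookup_single when_def)

lemma laurent_eq_uminus_iff: "(x :: laurent) = - x \<longleftrightarrow> x = 0"
proof
  assume "x = - x"
  then have "Poly_Mapping.lookup x k = - Poly_Mapping.lookup x k" for k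
    by (metis lookup_uminus)
  then show "x = 0" by (intro poly_mapping_eqI) simp
qed simp

text \<open>The sign determines the parity of each word that occurs, since a nonzero Laurent
  polynomial over the complex numbers never equals its negative.\<close>

lemma homog_free_salgebra_iff:
  "f \<in> homog (free_salgebra X \<pi>) d \<longleftrightarrow>
    f \<in> free_carrier X \<and> parity_aut \<pi> f = scal (parity_sign d) * f"
proof -
  have "(\<Sum>g\<leftarrow>letters w. \<pi> g) = d \<longleftrightarrow>
      parity_sign (\<Sum>g\<leftarrow>letters w. \<pi> g) * Poly_Mapping.lookup f w = parity_sign d * Poly_Mapping.lookup f w"
    if "w \<in> Poly_Mapping.keys f" for w
    using that laurent_eq_uminus_iff[of "Poly_Mapping.lookup f w"]
    by (auto simp: parity_sign_def in_keys_iff eq_commute[of "- _" "_ :: laurent"])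
  then have "(\<forall>w\<in>Poly_Mapping.keys f. (\<Sum>g\<leftarrow>letters w. \<pi> g) = d) \<longleftrightarrow>
      (\<forall>w. Poly_Mapping.lookup (parity_aut \<pi> f) w = Poly_Mapping.lookup (scal (parity_sign d) * f) w)"
    unfolding lookup_parity_aut lookup_scal_mult by (metis in_keys_iff mult_zero_right)
  also have "\<dots> \<longleftrightarrow> parity_aut \<pi> f = scal (parity_sign d) * f"
    by (metis poly_mapping_eqI)
  finally have "(\<forall>w\<in>Poly_Mapping.keys f. (\<Sum>g\<leftarrow>letters w. \<pi> g) = d) \<longleftrightarrow>
      parity_aut \<pi> f = scal (parity_sign d) * f" .
  then show ?thesis by (auto simp: free_salgebra_def free_carrier_def)
qed

lemma parity_aut_invol: "parity_aut \<pi> (parity_aut \<pi> f) = f"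
  by (rule poly_mapping_eqI) (simp add: lookup_parity_aut flip: mult.assoc)

lemma parity_aut_closed: "f \<in> free_carrier X \<Longrightarrow> parity_aut \<pi> f \<in> free_carrier X"
  unfolding parity_aut_def by (rule subst_closed) auto

lemma parity_aut_subst:
  assumes "f \<in> free_carrier Y" "\<And>g. g \<in> Y \<Longrightarrow> parity_aut \<pi> (v g) = scal (parity_sign (p g)) * v g"
  shows "parity_aut \<pi> (subst v f) = subst v (parity_aut p f)"
proof -
  have "subst v (parity_aut p f) = subst (\<lambda>g. scal (parity_sign (p g)) * v g) f"
    unfolding parity_aut_def using assms(1) by (rule subst_subst) (simp add: subst_mult)
  moreover have "parity_aut \<pi> (subst v f) = subst (\<lambda>g. scal (parity_sign (p g)) * v g) f"
    using assms(1) unfolding parity_aut_def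
    by (rule subst_subst) (rule assms(2)[unfolded parity_aut_def])
  ultimately show ?thesis by simp
qed

text \<open>If \<open>f\<close> satisfies the right-hand side, then it is congruent to its component
  \<open>(f + (\<plusminus> \<theta>(f))) / 2\<close> of parity \<open>d\<close>.\<close>

lemma presented_class_homog_iff:
  assumes R: "R \<subseteq> free_carrier X" and stable: "\<And>r. r \<in> R \<Longrightarrow> parity_aut \<pi> r \<in> Idl\<^bsub>free_salgebra X \<pi>\<^esub> R"
    and f: "f \<in> free_carrier X"
  shows "presented_class X \<pi> R f \<in> homog (presented X \<pi> R) d \<longleftrightarrow>
    parity_aut \<pi> f - scal (parity_sign d) * f \<in> Idl\<^bsub>free_salgebra X \<pi>\<^esub> R"
proof -
  let ?I = "Idl\<^bsub>free_salgebra X \<pi>\<^esub> R" and ?s = "scal (parity_sign d) :: 'a falg"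
  note I = two_sidedD[OF two_sided_Idl[OF R, of \<pi>]]
  have aut: "parity_aut \<pi> g \<in> ?I" if "g \<in> ?I" for g
    using subst_Idl[OF R two_sided_Idl[OF R], of "\<lambda>g. scal (parity_sign (\<pi> g)) * var g"] that stable
    unfolding parity_aut_def by auto
  have ss: "?s * ?s = 1" by (simp flip: scal_mult)
  show ?thesis
  proof
    assume "presented_class X \<pi> R f \<in> homog (presented X \<pi> R) d"
    then obtain g where g: "g \<in> free_carrier X" "parity_aut \<pi> g = ?s * g" "f - g \<in> ?I"
      by (auto simp: presented_simps[OF R] homog_free_salgebra_iff presented_class_eq_iff[OF R])
    have "parity_aut \<pi> (f - g) - ?s * (f - g) \<in> ?I"
      by (intro I(7,8) aut g(3))
    then show "parity_aut \<pi> f - ?s * f \<in> ?I"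
      using g(2) by (simp add: parity_aut_simps right_diff_distrib)
  next
    assume *: "parity_aut \<pi> f - ?s * f \<in> ?I"
    \<comment> \<open>The constant one half, which makes \<open>g\<close> below the component of
      \<open>f\<close> of parity \<open>d\<close>.\<close>
    define h where "h = (scal (Poly_Mapping.single 0 (1/2)) :: 'a falg)"
    have hh: "h + h = 1"
      by (simp add: h_def flip: scal_add single_add)
    define g where "g = h * (f + ?s * parity_aut \<pi> f)"
    have "parity_aut \<pi> g = h * (parity_aut \<pi> f + ?s * f)"
      unfolding g_def h_def by (simp add: parity_aut_simps parity_aut_invol)
    also have "\<dots> = ?s * g"
    proof -
      have "?s * g = h * (?s * f + (?s * ?s) * parity_aut \<pi> f)"
        using scal_central[of "parity_sign d" h] unfolding g_def
        by (simp add: mult.assoc[symmetric] distrib_left)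
      then show ?thesis by (simp add: ss add.commute)
    qed
    finally have "g \<in> homog (free_salgebra X \<pi>) d"
      unfolding homog_free_salgebra_iff by (simp add: g_def h_def f parity_aut_closed)
    moreover have "f - g = - (h * (?s * (parity_aut \<pi> f - ?s * f)))"
    proof -
      have "f - g = (h + h) * f - g" by (simp add: hh)
      also have "\<dots> = - (h * (?s * parity_aut \<pi> f - (?s * ?s) * f))"
        unfolding g_def ss by (simp add: algebra_simps)
      finally show ?thesis by (simp add: right_diff_distrib mult.assoc)
    qed
    then have "f - g \<in> ?I"
      unfolding h_def by (simp only:) (intro I(6,8) *)
    then have "presented_class X \<pi> R f = presented_class X \<pi> R g"
      by (simp add: presented_class_eq_iff[OF R])
    ultimately show "presented_class X \<pi> R f \<in> homog (presented X \<pi> R) d"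
      by (simp add: presented_simps(6)[OF R])
  qed
qed

text \<open>The map sends the class of a polynomial in the names \<open>Y\<close> to the class of
  the same polynomial on the other side. By \<open>key\<close> it is well defined and injective.
  Homogeneity transfers as well, since \<open>presented_class_homog_iff\<close> expresses it as
  membership in the ideals.\<close>

lemma sub_salgebra_isomorphicI:
  fixes X :: "'g set" and X' :: "'h set" and Y :: "'k set"
  assumes R: "R \<subseteq> free_carrier X" "\<And>r. r \<in> R \<Longrightarrow> parity_aut \<pi> r \<in> Idl\<^bsub>free_salgebra X \<pi>\<^esub> R"
    and R': "R' \<subseteq> free_carrier X'" "\<And>r. r \<in> R' \<Longrightarrow> parity_aut \<pi>' r \<in> Idl\<^bsub>free_salgebra X' \<pi>'\<^esub> R'"
    and v: "\<And>g. g \<in> Y \<Longrightarrow> v g \<in> free_carrier X"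
      "\<And>g. g \<in> Y \<Longrightarrow> parity_aut \<pi> (v g) = scal (parity_sign (p g)) * v g"
    and v': "\<And>g. g \<in> Y \<Longrightarrow> v' g \<in> free_carrier X'"
      "\<And>g. g \<in> Y \<Longrightarrow> parity_aut \<pi>' (v' g) = scal (parity_sign (p g)) * v' g"
    and key: "\<And>f. f \<in> free_carrier Y \<Longrightarrow>
      subst v f \<in> Idl\<^bsub>free_salgebra X \<pi>\<^esub> R \<longleftrightarrow> subst v' f \<in> Idl\<^bsub>free_salgebra X' \<pi>'\<^esub> R'"
  shows "salgebra_isomorphic
    (sub_salgebra (presented X \<pi> R) ((\<lambda>g. presented_class X \<pi> R (v g)) ` Y))
    (sub_salgebra (presented X' \<pi>' R') ((\<lambda>g. presented_class X' \<pi>' R' (v' g)) ` Y))"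
    (is "salgebra_isomorphic ?A ?B")
proof -
  define cl where "cl f = presented_class X \<pi> R (subst v f)" for f
  define cl' where "cl' f = presented_class X' \<pi>' R' (subst v' f)" for f
  note closed = subst_closed[of _ Y v X, OF _ v(1)] and closed' = subst_closed[of _ Y v' X', OF _ v'(1)]
  have cl_eq_iff: "cl f = cl g \<longleftrightarrow> cl' f = cl' g" if "f \<in> free_carrier Y" "g \<in> free_carrier Y" for f g
    using key[of "f - g"] that
    by (simp add: cl_def cl'_def presented_class_eq_iff[OF R(1)] presented_class_eq_iff[OF R'(1)] subst_diff)
  \<comment> \<open>A class has many representing polynomials; by \<open>cl_eq_iff\<close> the value
    does not depend on the one chosen.\<close>
  define h where "h K = cl' (SOME f. f \<in> free_carrier Y \<and> K = cl f)" for K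
  have h: "h (cl f) = cl' f" if "f \<in> free_carrier Y" for f
  proof -
    have "(SOME g. g \<in> free_carrier Y \<and> cl f = cl g) \<in> free_carrier Y \<and>
        cl f = cl (SOME g. g \<in> free_carrier Y \<and> cl f = cl g)"
      by (rule someI[where x = f]) (simp add: that)
    then show ?thesis unfolding h_def using cl_eq_iff[OF that] by metis
  qed
  have carr: "carrier ?A = cl ` free_carrier Y" "carrier ?B = cl' ` free_carrier Y"
    using gen_span_presented[OF R(1) v(1), where \<pi> = \<pi>] gen_span_presented[OF R'(1) v'(1), where \<pi> = \<pi>']
    by (simp_all add: sub_salgebra_def cl_def cl'_def)
  have homog_iff: "cl f \<in> homog ?A d \<longleftrightarrow> cl' f \<in> homog ?B d" if f: "f \<in> free_carrier Y" for f d
  proof -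
    have "cl f \<in> homog ?A d \<longleftrightarrow> cl f \<in> homog (presented X \<pi> R) d"
      using carr(1) f by (auto simp: sub_salgebra_def)
    also have "\<dots> \<longleftrightarrow> subst v (parity_aut p f - scal (parity_sign d) * f) \<in> Idl\<^bsub>free_salgebra X \<pi>\<^esub> R"
      unfolding cl_def by (subst presented_class_homog_iff[OF R closed[OF f]])
        (simp_all add: subst_simps parity_aut_subst[OF f v(2)])
    also have "\<dots> \<longleftrightarrow> subst v' (parity_aut p f - scal (parity_sign d) * f) \<in> Idl\<^bsub>free_salgebra X' \<pi>'\<^esub> R'"
      by (rule key) (simp add: f parity_aut_closed)
    also have "\<dots> \<longleftrightarrow> cl' f \<in> homog (presented X' \<pi>' R') d"
      unfolding cl'_def by (subst presented_class_homog_iff[OF R' closed'[OF f]])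
        (simp_all add: subst_simps parity_aut_subst[OF f v'(2)])
    also have "\<dots> \<longleftrightarrow> cl' f \<in> homog ?B d"
      using carr(2) f by (auto simp: sub_salgebra_def)
    finally show ?thesis .
  qed
  have ops: "cl f \<otimes>\<^bsub>?A\<^esub> cl g = cl (f * g)" "cl f \<oplus>\<^bsub>?A\<^esub> cl g = cl (f + g)"
      "cl' f \<otimes>\<^bsub>?B\<^esub> cl' g = cl' (f * g)" "cl' f \<oplus>\<^bsub>?B\<^esub> cl' g = cl' (f + g)"
    if "f \<in> free_carrier Y" "g \<in> free_carrier Y" for f g
    using that by (simp_all add: sub_salgebra_def cl_def cl'_def closed closed' subst_simps
        presented_simps(2,3)[OF R(1)] presented_simps(2,3)[OF R'(1)])
  have ones: "\<one>\<^bsub>?A\<^esub> = cl 1" "\<one>\<^bsub>?B\<^esub> = cl' 1"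
    by (simp_all add: sub_salgebra_def cl_def cl'_def presented_simps(4)[OF R(1)] presented_simps(4)[OF R'(1)])
  have "h \<in> ring_hom ?A ?B"
    by (rule ring_hom_memI) (auto simp: carr ones ops h)
  moreover have "bij_betw h (carrier ?A) (carrier ?B)"
    unfolding bij_betw_def inj_on_def carr by (auto simp: h cl_eq_iff image_image)
  moreover have "\<forall>c. \<forall>x\<in>carrier ?A. h (c \<odot>\<^bsub>?A\<^esub> x) = c \<odot>\<^bsub>?B\<^esub> h x"
  proof (unfold carr, intro allI ballI)
    fix c x assume "x \<in> cl ` free_carrier Y"
    then obtain f where f: "f \<in> free_carrier Y" "x = cl f" by blast
    have "c \<odot>\<^bsub>?A\<^esub> x = cl (scal c * f)" "c \<odot>\<^bsub>?B\<^esub> cl' f = cl' (scal c * f)"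
      using f by (simp_all add: sub_salgebra_def cl_def cl'_def closed closed' subst_mult
        presented_simps(5)[OF R(1)] presented_simps(5)[OF R'(1)])
    then show "h (c \<odot>\<^bsub>?A\<^esub> x) = c \<odot>\<^bsub>?B\<^esub> h x" using f by (simp add: h)
  qed
  moreover have "h ` homog ?A d = homog ?B d" for d
  proof -
    have "homog ?A d = cl ` {f \<in> free_carrier Y. cl f \<in> homog ?A d}"
      using carr(1) by (auto simp: sub_salgebra_def)
    moreover have "homog ?B d = cl' ` {f \<in> free_carrier Y. cl' f \<in> homog ?B d}"
      using carr(2) by (auto simp: sub_salgebra_def)
    moreover have "{f \<in> free_carrier Y. cl f \<in> homog ?A d} = {f \<in> free_carrier Y. cl' f \<in> homog ?B d}"
      using homog_iff by blast
    moreover have "h ` cl ` F = cl' ` F" if "F \<subseteq> free_carrier Y" for F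
      unfolding image_image by (rule image_cong) (use that h in auto)
    ultimately show ?thesis by (metis (no_types, lifting) mem_Collect_eq subsetI)
  qed
  ultimately have "h \<in> salgebra_iso ?A ?B"
    by (simp add: salgebra_iso_def ring_iso_def)
  then show ?thesis unfolding salgebra_isomorphic_def by blast
qed

section \<open>Two-column quantum matrices and their minors\<close>

text \<open>The Manin relations between a row \<open>x\<close> and a lower row \<open>y\<close> of a matrix with two even
  columns; \<open>s\<close> is the Koszul sign of the two rows, and \<open>qi\<close> stands for \<open>q\<^sup>-\<^sup>1\<close>.\<close>

definition qcomm :: "'r::{ring,monoid_mult} \<Rightarrow> 'r \<Rightarrow> 'r \<Rightarrow> 'r \<Rightarrow> 'r \<Rightarrow> 'r \<Rightarrow> 'r \<Rightarrow> bool" where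
  "qcomm q qi s x1 x2 y1 y2 \<longleftrightarrow>
     x1 * y1 = s * (qi * (y1 * x1)) \<and> x2 * y2 = s * (qi * (y2 * x2)) \<and> x2 * y1 = s * (y1 * x2) \<and>
     x1 * y2 = s * (y2 * x1) + s * ((qi - q) * (y1 * x2))"

text \<open>The relations inside one row of parity \<open>p\<close>. In an odd row the Koszul sign
  of the two entries is \<open>-1\<close> and the exponent of \<open>q\<close> is reversed.\<close>

definition qrow :: "'r::{ring,monoid_mult} \<Rightarrow> 'r \<Rightarrow> bit \<Rightarrow> 'r \<Rightarrow> 'r \<Rightarrow> bool" where
  "qrow q qi p x1 x2 \<longleftrightarrow>
     (if p = 0 then x1 * x2 = qi * (x2 * x1)
      else x1 * x2 = - (q * (x2 * x1)) \<and> x1 * x1 = 0 \<and> x2 * x2 = 0)"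

definition ring_sign :: "bit \<Rightarrow> bit \<Rightarrow> 'r::{ring,monoid_mult}" where
  "ring_sign d e = (if d = 1 \<and> e = 1 then - 1 else 1)"

lemma ring_sign_0: "ring_sign 0 e = 1" "ring_sign d 0 = 1"
  by (simp_all add: ring_sign_def)

text \<open>In products nested to the right an exchange rule must also fire with a tail
  \<open>w\<close> behind the pair being exchanged.\<close>

lemma assoc_eq: "x * y = z \<Longrightarrow> x * (y * w) = z * w" for x :: "'r::{ring,monoid_mult}"
  by (simp add: mult.assoc[symmetric])

lemma qcommD:
  assumes "qcomm q qi 1 x1 x2 y1 y2"
  shows "x1 * y1 = qi * (y1 * x1)" "x2 * y2 = qi * (y2 * x2)" "x2 * y1 = y1 * x2"
    "x1 * y2 = y2 * x1 + (qi - q) * (y1 * x2)"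
  using assms by (simp_all add: qcomm_def)

lemma qcomm_minusD:
  assumes "qcomm q qi (- 1) x1 x2 y1 y2"
  shows "x1 * y1 = - (qi * (y1 * x1))" "x2 * y2 = - (qi * (y2 * x2))" "x2 * y1 = - (y1 * x2)"
    "x1 * y2 = - (y2 * x1) - (qi - q) * (y1 * x2)"
  using assms by (simp_all add: qcomm_def)

lemmas qcomm_rules = qcommD qcommD[THEN assoc_eq]
lemmas qcomm_minus_rules = qcomm_minusD qcomm_minusD[THEN assoc_eq]

lemma qrow_evenD: "qrow q qi 0 x1 x2 \<Longrightarrow> x1 * x2 = qi * (x2 * x1)"
  by (simp add: qrow_def)

lemma qrow_oddD:
  assumes "qrow q qi 1 x1 x2"
  shows "x1 * x2 = - (q * (x2 * x1))" "x1 * x1 = 0" "x2 * x2 = 0"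
  using assms by (simp_all add: qrow_def)

lemmas qrow_even_rules = qrow_evenD qrow_evenD[THEN assoc_eq]
lemmas qrow_odd_rules = qrow_oddD qrow_oddD[THEN assoc_eq]

locale q_scalars =
  fixes q qi :: "'r::{ring,monoid_mult}"
  assumes q_qi: "q * qi = 1" and qi_q: "qi * q = 1"
begin

text \<open>The scalars \<open>q\<close> and \<open>qi\<close> are not assumed central in
  \<open>'r\<close>, so commutation with them is recorded element by element.\<close>

definition scalar_comm :: "'r \<Rightarrow> bool" where
  "scalar_comm x \<longleftrightarrow> x * q = q * x \<and> x * qi = qi * x"

lemma scalar_commD: "scalar_comm x \<Longrightarrow> x * q = q * x" "scalar_comm x \<Longrightarrow> x * qi = qi * x"
  by (simp_all add: scalar_comm_def)

lemmas scalar_comm_rules = scalar_commD scalar_commD[THEN assoc_eq]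
lemmas q_rules = q_qi qi_q q_qi[THEN assoc_eq] qi_q[THEN assoc_eq]

lemma scalar_comm_mult: "scalar_comm x \<Longrightarrow> scalar_comm y \<Longrightarrow> scalar_comm (x * y)"
  unfolding scalar_comm_def by (metis mult.assoc)

lemma scalar_comm_diff: "scalar_comm x \<Longrightarrow> scalar_comm y \<Longrightarrow> scalar_comm (x - y)"
  by (simp add: scalar_comm_def algebra_simps)

lemma scalar_comm_scalars: "scalar_comm q" "scalar_comm qi"
  by (simp_all add: scalar_comm_def q_qi qi_q)

text \<open>Quantum determinant of the rows \<open>x\<close> and \<open>y\<close>: the value of
  \<open>minor\<close> in a target ring.\<close>

definition qdet :: "'r \<Rightarrow> 'r \<Rightarrow> 'r \<Rightarrow> 'r \<Rightarrow> 'r" where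
  "qdet x1 x2 y1 y2 = x1 * y2 - qi * (x2 * y1)"

context
  fixes x1 x2 y1 y2 z1 z2 :: 'r
  assumes xy: "qcomm q qi 1 x1 x2 y1 y2" and xz: "qcomm q qi 1 x1 x2 z1 z2" and yz: "qcomm q qi 1 y1 y2 z1 z2"
    and x: "qrow q qi 0 x1 x2" and y: "qrow q qi 0 y1 y2"
    and c: "scalar_comm x1" "scalar_comm x2" "scalar_comm y1" "scalar_comm y2" "scalar_comm z1" "scalar_comm z2"
begin

text \<open>Normal ordering: scalars move to the front, lower rows move left of the rows above them,
  and within the rows \<open>x\<close> and \<open>y\<close> column 2 moves left of column 1.
  Identities between minors reduce to comparing normal forms.\<close>

lemmas rules3 = qcomm_rules[OF xy] qcomm_rules[OF xz] qcomm_rules[OF yz]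
  qrow_even_rules[OF x] qrow_even_rules[OF y] c[THEN scalar_comm_rules(1)] c[THEN scalar_comm_rules(2)]
  c[THEN scalar_comm_rules(3)] c[THEN scalar_comm_rules(4)] q_rules algebra_simps

text \<open>For the first two rows \<open>x\<close>, \<open>y\<close> these exchange
  \<open>D_12\<close> with \<open>D_1i\<close> and \<open>D_2i\<close>; they are what allows the
  inverse of \<open>D_12\<close> to be moved past the other minors.\<close>

lemma qdet_comm:
  "qdet x1 x2 y1 y2 * qdet x1 x2 z1 z2 = qi * (qdet x1 x2 z1 z2 * qdet x1 x2 y1 y2)"
  "qdet x1 x2 y1 y2 * qdet y1 y2 z1 z2 = qi * (qdet y1 y2 z1 z2 * qdet x1 x2 y1 y2)"
  unfolding qdet_def by (simp_all add: rules3)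

text \<open>The rows \<open>x\<close> and \<open>y\<close> are even, so the pair
  \<open>D_1i\<close>, \<open>D_2i\<close> keeps the parity of row \<open>i\<close>, with
  \<open>D_1i\<close> in the place of the first column.\<close>

lemma qrow_qdet:
  assumes "qrow q qi p z1 z2"
  shows "qrow q qi p (qdet x1 x2 z1 z2) (qdet y1 y2 z1 z2)"
proof (cases p)
  case zero
  with assms have z: "qrow q qi 0 z1 z2" by simp
  show ?thesis using zero unfolding qrow_def qdet_def
    by (simp add: rules3 qrow_even_rules[OF z])
next
  case one
  with assms have z: "qrow q qi 1 z1 z2" by simp
  show ?thesis using one unfolding qrow_def qdet_def
    by (simp add: rules3 qrow_odd_rules[OF z])
qed

lemma qcomm_qdet:
  assumes xv: "qcomm q qi 1 x1 x2 v1 v2" and yv: "qcomm q qi 1 y1 y2 v1 v2"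
    and zv: "qcomm q qi (ring_sign d e) z1 z2 v1 v2" and v: "scalar_comm v1" "scalar_comm v2"
  shows "qcomm q qi (ring_sign d e) (qdet x1 x2 z1 z2) (qdet y1 y2 z1 z2) (qdet x1 x2 v1 v2) (qdet y1 y2 v1 v2)"
proof -
  note rules4 = rules3 qcomm_rules[OF xv] qcomm_rules[OF yv] v[THEN scalar_comm_rules(1)]
    v[THEN scalar_comm_rules(2)] v[THEN scalar_comm_rules(3)] v[THEN scalar_comm_rules(4)]
  show ?thesis
  proof (cases "d = 1 \<and> e = 1")
    case True
    with zv have zv': "qcomm q qi (- 1) z1 z2 v1 v2" by (simp add: ring_sign_def)
    show ?thesis using True unfolding qcomm_def qdet_def ring_sign_def
      by (simp add: rules4 qcomm_minus_rules[OF zv'])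
  next
    case False
    with zv have zv': "qcomm q qi 1 z1 z2 v1 v2" by (auto simp: ring_sign_def)
    have "qcomm q qi 1 (qdet x1 x2 z1 z2) (qdet y1 y2 z1 z2) (qdet x1 x2 v1 v2) (qdet y1 y2 v1 v2)"
     unfolding qcomm_def qdet_def 
      by (simp add: rules4 qcomm_rules[OF zv'])
    then show ?thesis using False by (auto simp: ring_sign_def)
  qed
qed

end

section \<open>Division of minors by \<open>D_12\<close>\<close>

lemma inverse_comm:
  assumes dw: "d * w = 1" "w * d = 1" and du: "d * u = qi * (u * d)"
    and c: "scalar_comm w"
  shows "w * u = q * (u * w)"
proof -
  have "w * u = w * (u * d) * w" by (simp add: mult.assoc dw)
  also have "u * d = q * (d * u)" by (simp add: du q_rules)
  also have "w * (q * (d * u)) * w = q * (w * d) * (u * w)"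
    by (simp add: mult.assoc scalar_comm_rules[OF c])
  finally show ?thesis by (simp add: dw)
qed

lemma scalar_comm_inverse:
  assumes dw: "d * w = 1" "w * d = 1" and d: "scalar_comm d"
  shows "scalar_comm w"
proof -
  have "w * s = s * w" if "d * s = s * d" for s
  proof -
    have "w * (d * s) * w = w * (s * d) * w" using that by simp
    then show ?thesis by (simp add: mult.assoc dw dw[THEN assoc_eq])
  qed
  with d show ?thesis by (simp add: scalar_comm_def)
qed

context
  fixes w x1 x2 :: 'r
  assumes w: "scalar_comm w" and x: "scalar_comm x1" "scalar_comm x2"
    and wx: "w * x1 = q * (x1 * w)" "w * x2 = q * (x2 * w)"
begin

text \<open>The relations are quadratic, so collecting the factors \<open>w\<close> on the right
  gives the same power of \<open>q\<close> in each monomial. All monomials of one relation also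
  contain equally many second-column entries, so the factor \<open>- qi\<close> is harmless. The
  same argument gives \<open>qcomm_div\<close>.\<close>

lemma qrow_div:
  assumes "qrow q qi p x1 x2"
  shows "qrow q qi p (x1 * w) (- (qi * (x2 * w)))"
proof -
  note rules = scalar_comm_rules[OF w] scalar_comm_rules[OF x(1)] scalar_comm_rules[OF x(2)]
    wx wx[THEN assoc_eq] q_rules algebra_simps
  show ?thesis
  proof (cases p)
    case zero
    with assms have z: "qrow q qi 0 x1 x2" by simp
    show ?thesis using zero unfolding qrow_def
      by (simp add: rules qrow_even_rules[OF z])
  next
    case one
    with assms have z: "qrow q qi 1 x1 x2" by simp
    show ?thesis using one unfolding qrow_def
      by (simp add: rules qrow_odd_rules[OF z])
  qed
qed

lemma qcomm_div:
  assumes xy: "qcomm q qi (ring_sign d e) x1 x2 y1 y2" and y: "scalar_comm y1" "scalar_comm y2"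
    and wy: "w * y1 = q * (y1 * w)" "w * y2 = q * (y2 * w)"
  shows "qcomm q qi (ring_sign d e) (x1 * w) (- (qi * (x2 * w))) (y1 * w) (- (qi * (y2 * w)))"
proof -
  note rules = scalar_comm_rules[OF w] scalar_comm_rules[OF x(1)] scalar_comm_rules[OF x(2)]
    scalar_comm_rules[OF y(1)] scalar_comm_rules[OF y(2)]
    wx wx[THEN assoc_eq] wy wy[THEN assoc_eq] q_rules algebra_simps
  show ?thesis
  proof (cases "d = 1 \<and> e = 1")
    case True
    with xy have xy': "qcomm q qi (- 1) x1 x2 y1 y2" by (simp add: ring_sign_def)
    show ?thesis using True unfolding qcomm_def ring_sign_def
      by (simp add: rules qcomm_minus_rules[OF xy'])
  next
    case False
    with xy have xy': "qcomm q qi 1 x1 x2 y1 y2" by (auto simp: ring_sign_def)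
    have "qcomm q qi 1 (x1 * w) (- (qi * (x2 * w))) (y1 * w) (- (qi * (y2 * w)))"
      unfolding qcomm_def by (simp add: rules qcomm_rules[OF xy'])
    then show ?thesis using False by (auto simp: ring_sign_def)
  qed
qed

end

definition two_col :: "nat set \<Rightarrow> (nat \<Rightarrow> bit) \<Rightarrow> (nat \<Rightarrow> nat \<Rightarrow> 'r) \<Rightarrow> bool" where
  "two_col I pr a \<longleftrightarrow> (\<forall>i\<in>I. qrow q qi (pr i) (a i 1) (a i 2)) \<and>
     (\<forall>i\<in>I. \<forall>k\<in>I. i < k \<longrightarrow> qcomm q qi (ring_sign (pr i) (pr k)) (a i 1) (a i 2) (a k 1) (a k 2))"

lemma two_colD:
  assumes "two_col I pr a"
  shows "i \<in> I \<Longrightarrow> qrow q qi (pr i) (a i 1) (a i 2)"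
    "i \<in> I \<Longrightarrow> k \<in> I \<Longrightarrow> i < k \<Longrightarrow> qcomm q qi (ring_sign (pr i) (pr k)) (a i 1) (a i 2) (a k 1) (a k 2)"
  using assms by (auto simp: two_col_def)

text \<open>Two stages: \<open>qrow_qdet\<close> and \<open>qcomm_qdet\<close> carry the relations
  from rows to minors, then \<open>qrow_div\<close> and \<open>qcomm_div\<close> carry them to the
  quotients by \<open>D_12\<close>.\<close>

lemma two_col_minors:
  fixes a :: "nat \<Rightarrow> nat \<Rightarrow> 'r" and w :: 'r
  assumes a: "two_col {1..6} pr a" and pr: "pr 1 = 0" "pr 2 = 0"
    and c: "\<And>i j. scalar_comm (a i j)"
    and w: "qdet (a 1 1) (a 1 2) (a 2 1) (a 2 2) * w = 1" "w * qdet (a 1 1) (a 1 2) (a 2 1) (a 2 2) = 1"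
    and b: "\<And>i. i \<in> {3..6} \<Longrightarrow> b i 1 = qdet (a 1 1) (a 1 2) (a i 1) (a i 2) * w"
      "\<And>i. i \<in> {3..6} \<Longrightarrow> b i 2 = - (qi * (qdet (a 2 1) (a 2 2) (a i 1) (a i 2) * w))"
  shows "two_col {3..6} pr b"
proof -
  let ?D = "\<lambda>r s. qdet (a r 1) (a r 2) (a s 1) (a s 2)"
  have row: "qrow q qi 0 (a 1 1) (a 1 2)" "qrow q qi 0 (a 2 1) (a 2 2)"
    using two_colD(1)[OF a, of 1] two_colD(1)[OF a, of 2] pr by simp_all
  have q12: "qcomm q qi 1 (a 1 1) (a 1 2) (a 2 1) (a 2 2)"
    using two_colD(2)[OF a, of 1 2] pr by (simp add: ring_sign_0)
  have q1: "qcomm q qi 1 (a 1 1) (a 1 2) (a i 1) (a i 2)" and q2: "qcomm q qi 1 (a 2 1) (a 2 2) (a i 1) (a i 2)"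
    if "i \<in> {3..6}" for i
    using two_colD(2)[OF a, of 1 i] two_colD(2)[OF a, of 2 i] pr that by (auto simp: ring_sign_0)
  have cD: "scalar_comm (?D r s)" for r s
    unfolding qdet_def by (intro scalar_comm_diff scalar_comm_mult scalar_comm_scalars c)
  have cw: "scalar_comm w" by (rule scalar_comm_inverse[OF w cD])
  have wD: "w * ?D 1 i = q * (?D 1 i * w)" "w * ?D 2 i = q * (?D 2 i * w)" if i: "i \<in> {3..6}" for i
    using qdet_comm[OF q12 q1[OF i] q2[OF i] row c c c c c c]
    by (blast intro: inverse_comm[OF w _ cw])+
  show ?thesis
    unfolding two_col_def
  proof (intro conjI ballI impI)
    fix i :: nat assume i: "i \<in> {3..6}"
    then have "qrow q qi (pr i) (a i 1) (a i 2)" by (intro two_colD(1)[OF a]) auto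
    from qrow_div[OF cw cD cD wD[OF i] qrow_qdet[OF q12 q1[OF i] q2[OF i] row c c c c c c this]]
    show "qrow q qi (pr i) (b i 1) (b i 2)" by (simp only: b[OF i])
  next
    fix i k :: nat assume i: "i \<in> {3..6}" and k: "k \<in> {3..6}" and "i < k"
    then have "qcomm q qi (ring_sign (pr i) (pr k)) (a i 1) (a i 2) (a k 1) (a k 2)"
      by (intro two_colD(2)[OF a]) auto
    from qcomm_div[OF cw cD cD wD[OF i] qcomm_qdet[OF q12 q1[OF i] q2[OF i] row c c c c c c
          q1[OF k] q2[OF k] this c c] cD cD wD[OF k]]
    show "qcomm q qi (ring_sign (pr i) (pr k)) (b i 1) (b i 2) (b k 1) (b k 2)"
      by (simp only: b[OF i] b[OF k])
  qed
qed

end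

section \<open>Manin relations in terms of \<open>two_col\<close>\<close>

context falg_hom
begin

lemma q_scalars_scalars: "q_scalars (\<iota> qvar) (\<iota> qinv)"
proof
  show "\<iota> qvar * \<iota> qinv = 1" "\<iota> qinv * \<iota> qvar = 1"
    using qvar_qinv by (simp_all flip: scalar_mult add: scalar_one mult.commute)
qed

sublocale q_scalars "\<iota> qvar" "\<iota> qinv"
  by (rule q_scalars_scalars)

lemma scalar_koszul: "\<iota> (koszul d e) = ring_sign d e"
  by (simp add: koszul_def ring_sign_def scalar_one scalar_uminus)

end

lemma (in falg_hom) scalar_comm_var: "scalar_comm (v g)"
  by (simp add: scalar_comm_def scalar_commute)

lemma ring_sign_comm: "ring_sign d e = ring_sign e d"
  by (auto simp: ring_sign_def)

lemma ring_sign_left_commute: "x * (ring_sign d e * y) = ring_sign d e * (x * y)"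
  by (simp add: ring_sign_def)

lemma ring_sign_square: "ring_sign d e * (ring_sign d e * x) = x"
  by (simp add: ring_sign_def)

text \<open>Columns beyond the second are allowed if they are sent to zero: in a relation involving
  such a column every monomial then has a vanishing factor. This covers the two columns of
  \<open>Cq_S\<close> as well as the four of \<open>Mq22\<close>.\<close>

lemma eval_manin_relations:
  fixes v :: "gen \<Rightarrow> 'r::{ring,monoid_mult}"
  assumes hom: "falg_hom \<iota> v" and a: "q_scalars.two_col (\<iota> qvar) (\<iota> qinv) I pr (\<lambda>i j. v (Entry i j))"
    and pc: "pc 1 = 0" "pc 2 = 0" and J: "0 \<notin> J"
    and zero: "\<And>i j. i \<in> I \<Longrightarrow> j \<in> J \<Longrightarrow> j > 2 \<Longrightarrow> v (Entry i j) = 0"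
    and r: "r \<in> manin_relations I J pr pc"
  shows "eval \<iota> v r = 0"
proof -
  interpret falg_hom \<iota> v by (rule hom)
  have col: "j = 1 \<or> j = 2 \<or> j > 2" if "j \<in> J" for j
    using J that by (cases "j = 0") auto
  note row = two_colD(1)[OF a] and pair = two_colD(2)[OF a]
  note ev = eval_simps scalar_mult scalar_diff scalar_koszul
  have p: "entry_parity pr pc i 1 = pr i" "entry_parity pr pc i 2 = pr i"
     "entry_parity pr pc i (Suc 0) = pr i" for i
    using pc by (simp_all add: entry_parity_def)
  consider
      (square) i j where "i \<in> I" "j \<in> J" "entry_parity pr pc i j = 1" "r = ent i j * ent i j"
    | (row) i j l where "i \<in> I" "j \<in> J" "l \<in> J" "j < l"
        "r = ent i j * ent i l - scal (koszul (entry_parity pr pc i j) (entry_parity pr pc i l) * q_par (pr i)) * (ent i l * ent i j)"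
    | (column) i j k where "i \<in> I" "k \<in> I" "j \<in> J" "i < k"
        "r = ent i j * ent k j - scal (koszul (entry_parity pr pc i j) (entry_parity pr pc k j) * q_par (pc j)) * (ent k j * ent i j)"
    | (anti) i j k l where "i \<in> I" "k \<in> I" "j \<in> J" "l \<in> J" "i < k \<and> j > l \<or> i > k \<and> j < l"
        "r = ent i j * ent k l - scal (koszul (entry_parity pr pc i j) (entry_parity pr pc k l)) * (ent k l * ent i j)"
    | (main) i j k l where "i \<in> I" "k \<in> I" "j \<in> J" "l \<in> J" "i < k" "j < l"
        "r = ent i j * ent k l - scal (koszul (entry_parity pr pc i j) (entry_parity pr pc k l)) * (ent k l * ent i j)
          - scal (koszul (entry_parity pr pc i j) (entry_parity pr pc k l) * (qinv - qvar)) * (ent k j * ent i l)"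
    using r unfolding manin_relations_def Let_def by blast
  then show ?thesis
  proof cases
    case square
    with row[of i] col[of j] zero[of i j] show ?thesis
      by (auto simp: ev p qrow_def)
  next
    case row: (row i j l)
    show ?thesis
    proof (cases "l = 2")
      case True
      with row col[of j] have j: "j = 1" by auto
      show ?thesis using two_colD(1)[OF a row(1)] True j row(5)
        by (cases "pr i") (auto simp: ev p qrow_def q_par_def ring_sign_def mult.assoc)
    next
      case False
      \<comment> \<open>Columns start at 1, so \<open>j < l\<close> and \<open>l \<noteq> 2\<close>
        force \<open>l > 2\<close>.\<close>
      with row col[of j] col[of l] zero[of i l] show ?thesis by (auto simp: ev)
    qed
  next
    case column
    with pair[of i k] col[of j] zero[of i j] zero[of k j] pc show ?thesis
      by (auto simp: ev p qcomm_def q_par_def mult.assoc)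
  next
    case anti
    show ?thesis
    proof (cases "j > 2 \<or> l > 2")
      case True
      with anti zero[of i j] zero[of k l] show ?thesis
        using zero[of k j] zero[of i l] by (auto simp: ev)
    next
      case False
      with anti col[of j] col[of l] have "j = 2 \<and> l = 1 \<and> i < k \<or> j = 1 \<and> l = 2 \<and> k < i" by auto
      with anti pair[of i k] pair[of k i] show ?thesis
        by (auto simp: ev p qcomm_def ring_sign_comm[of "pr i" "pr k"] ring_sign_square)
    qed
  next
    case main
    show ?thesis
    proof (cases "l = 2")
      case True
      with main col[of j] have j: "j = 1" by auto
      show ?thesis using pair[OF main(1,2,5)] True j main(7)
        by (auto simp: ev p qcomm_def mult.assoc)
    next
      case False
      with main col[of j] col[of l] have "l > 2" by auto
      with main zero[of k l] zero[of i l] show ?thesis by (auto simp: ev)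
    qed
  qed
qed

lemma manin_relations_memI:
  fixes pr pc I J
  defines "p \<equiv> entry_parity pr pc" and "M \<equiv> manin_relations I J pr pc"
  shows "i \<in> I \<Longrightarrow> j \<in> J \<Longrightarrow> p i j = 1 \<Longrightarrow> ent i j * ent i j \<in> M"
    and "i \<in> I \<Longrightarrow> j \<in> J \<Longrightarrow> l \<in> J \<Longrightarrow> j < l \<Longrightarrow>
      ent i j * ent i l - scal (koszul (p i j) (p i l) * q_par (pr i)) * (ent i l * ent i j) \<in> M"
    and "i \<in> I \<Longrightarrow> k \<in> I \<Longrightarrow> j \<in> J \<Longrightarrow> i < k \<Longrightarrow>
      ent i j * ent k j - scal (koszul (p i j) (p k j) * q_par (pc j)) * (ent k j * ent i j) \<in> M"
    and "i \<in> I \<Longrightarrow> k \<in> I \<Longrightarrow> j \<in> J \<Longrightarrow> l \<in> J \<Longrightarrow> i < k \<and> j > l \<or> i > k \<and> j < l \<Longrightarrow>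
      ent i j * ent k l - scal (koszul (p i j) (p k l)) * (ent k l * ent i j) \<in> M"
    and "i \<in> I \<Longrightarrow> k \<in> I \<Longrightarrow> j \<in> J \<Longrightarrow> l \<in> J \<Longrightarrow> i < k \<Longrightarrow> j < l \<Longrightarrow>
      ent i j * ent k l - scal (koszul (p i j) (p k l)) * (ent k l * ent i j)
        - scal (koszul (p i j) (p k l) * (qinv - qvar)) * (ent k j * ent i l) \<in> M"
  unfolding M_def p_def manin_relations_def Let_def by blast+

text \<open>Converse of \<open>eval_manin_relations\<close> for the columns 1 and 2.\<close>

lemma two_colI_manin:
  fixes v :: "gen \<Rightarrow> 'r::{ring,monoid_mult}"
  assumes hom: "falg_hom \<iota> v" and pc: "pc 1 = 0" "pc 2 = 0"
    and kill: "\<And>r. r \<in> manin_relations I {1, 2} pr pc \<Longrightarrow> eval \<iota> v r = 0"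
  shows "q_scalars.two_col (\<iota> qvar) (\<iota> qinv) I pr (\<lambda>i j. v (Entry i j))"
proof -
  interpret falg_hom \<iota> v by (rule hom)
  note ev = eval_simps scalar_mult scalar_diff scalar_koszul
  have p: "entry_parity pr pc i 1 = pr i" "entry_parity pr pc i 2 = pr i"
     "entry_parity pr pc i (Suc 0) = pr i" for i
    using pc by (simp_all add: entry_parity_def)
  show ?thesis
    unfolding two_col_def
  proof (intro conjI ballI impI)
    fix i assume i: "i \<in> I"
    note 1 = kill[OF manin_relations_memI(2)[OF i, of 1 _ 2]]
    have 2: "eval \<iota> v (ent i j * ent i j) = 0" if "pr i = 1" "j = 1 \<or> j = 2" for j
      using that i p by (intro kill manin_relations_memI(1)) auto
    show "qrow (\<iota> qvar) (\<iota> qinv) (pr i) (v (Entry i 1)) (v (Entry i 2))"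
      using 1 2[of 1] 2[of 2]
      by (cases "pr i") (simp_all add: qrow_def ev p q_par_def ring_sign_def mult.assoc eq_neg_iff_add_eq_0)
  next
    fix i k assume ik: "i \<in> I" "k \<in> I" "i < k"
    note 1 = kill[OF manin_relations_memI(3)[OF ik(1,2) _ ik(3)]]
    note 2 = kill[OF manin_relations_memI(4)[OF ik(1,2), of 2 _ 1]]
    note 3 = kill[OF manin_relations_memI(5)[OF ik(1,2) _ _ ik(3), of 1 _ 2]]
    show "qcomm (\<iota> qvar) (\<iota> qinv) (ring_sign (pr i) (pr k))
        (v (Entry i 1)) (v (Entry i 2)) (v (Entry k 1)) (v (Entry k 2))"
      using 1[of 1] 1[of 2] 2 3 pc ik
      by (simp add: qcomm_def ev p q_par_def mult.assoc algebra_simps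
          ring_sign_left_commute[of "\<iota> qvar"] ring_sign_left_commute[of "\<iota> qinv"])
  qed
qed

section \<open>Quotient rings and rings of additive endomorphisms\<close>

lemma free_carrier_UNIV: "free_carrier UNIV = UNIV"
  by (simp add: free_carrier_def)

text \<open>Types \<open>'i\<close> of this class serve as names of two-sided ideals, so that each quotient by such an
  ideal is a type of class \<open>ring\<close>, on which the simplifier can do the normal ordering.\<close>

class alg_ideal =
  fixes alg_ideal :: "'a itself \<Rightarrow> gen falg set"
  assumes two_sided_alg_ideal: "two_sided UNIV (alg_ideal TYPE('a))"

lemmas alg_ideal_closed = two_sidedD(2-)[OF two_sided_alg_ideal, unfolded free_carrier_UNIV, simplified]

quotient_type (overloaded) 'i alg_quot = "gen falg" / "\<lambda>f g. f - g \<in> alg_ideal TYPE('i::alg_ideal)"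
  morphisms rep_quot proj
proof (rule equivpI)
  show "reflp (\<lambda>f g. f - g \<in> alg_ideal TYPE('i))"
    by (simp add: reflp_def alg_ideal_closed)
  show "symp (\<lambda>f g. f - g \<in> alg_ideal TYPE('i))"
    by (rule sympI) (metis alg_ideal_closed(5) minus_diff_eq)
  show "transp (\<lambda>f g. f - g \<in> alg_ideal TYPE('i))"
  proof (rule transpI)
    fix f g h :: "gen falg"
    assume "f - g \<in> alg_ideal TYPE('i)" "g - h \<in> alg_ideal TYPE('i::alg_ideal)"
    then have "(f - g) + (g - h) \<in> alg_ideal TYPE('i)" by (rule alg_ideal_closed)
    then show "f - h \<in> alg_ideal TYPE('i)" by simp
  qed
qed

instantiation alg_quot :: (alg_ideal) "{ring, monoid_mult}"
begin

lift_definition zero_alg_quot :: "'a alg_quot" is 0 .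
lift_definition one_alg_quot :: "'a alg_quot" is 1 .
lift_definition uminus_alg_quot :: "'a alg_quot \<Rightarrow> 'a alg_quot" is uminus
proof -
  fix f f' :: "gen falg"
  assume "f - f' \<in> alg_ideal TYPE('a)"
  then have "- (f - f') \<in> alg_ideal TYPE('a)" by (rule alg_ideal_closed)
  then show "- f - - f' \<in> alg_ideal TYPE('a)" by simp
qed
lift_definition plus_alg_quot :: "'a alg_quot \<Rightarrow> 'a alg_quot \<Rightarrow> 'a alg_quot" is "(+)"
proof -
  fix f f' g g' :: "gen falg"
  assume "f - f' \<in> alg_ideal TYPE('a)" "g - g' \<in> alg_ideal TYPE('a)"
  then have "(f - f') + (g - g') \<in> alg_ideal TYPE('a)" by (rule alg_ideal_closed)
  then show "f + g - (f' + g') \<in> alg_ideal TYPE('a)" by (simp add: algebra_simps)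
qed
lift_definition minus_alg_quot :: "'a alg_quot \<Rightarrow> 'a alg_quot \<Rightarrow> 'a alg_quot" is "(-)"
proof -
  fix f f' g g' :: "gen falg"
  assume "f - f' \<in> alg_ideal TYPE('a)" "g - g' \<in> alg_ideal TYPE('a)"
  then have "(f - f') - (g - g') \<in> alg_ideal TYPE('a)" by (rule alg_ideal_closed)
  then show "f - g - (f' - g') \<in> alg_ideal TYPE('a)" by (simp add: algebra_simps)
qed
lift_definition times_alg_quot :: "'a alg_quot \<Rightarrow> 'a alg_quot \<Rightarrow> 'a alg_quot" is "(*)"
proof -
  fix f f' g g' :: "gen falg"
  assume "f - f' \<in> alg_ideal TYPE('a)" "g - g' \<in> alg_ideal TYPE('a)"
  then have "(f - f') * g + f' * (g - g') \<in> alg_ideal TYPE('a)" by (intro alg_ideal_closed(2,3,4))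
  then show "f * g - f' * g' \<in> alg_ideal TYPE('a)" by (simp add: algebra_simps)
qed

instance
  by standard (transfer, simp add: algebra_simps alg_ideal_closed(1))+

end

lemma proj_simps:
  "proj (f + g) = proj f + proj g" "proj (f - g) = proj f - proj g" "proj (- f) = - proj f"
  "proj (f * g) = proj f * proj g" "proj 1 = 1" "proj 0 = 0"
  by (simp_all add: plus_alg_quot.abs_eq minus_alg_quot.abs_eq uminus_alg_quot.abs_eq
      times_alg_quot.abs_eq one_alg_quot.abs_eq zero_alg_quot.abs_eq)

lemma proj_eq_0_iff: "(proj f :: 'i::alg_ideal alg_quot) = 0 \<longleftrightarrow> f \<in> alg_ideal TYPE('i::alg_ideal)"
  by (simp add: zero_alg_quot.abs_eq alg_quot.abs_eq_iff)

lemma proj_surj: "\<exists>f. x = proj f"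
  using Quotient_abs_rep[OF Quotient_alg_quot, of x] by metis

lemma falg_hom_proj:
  "falg_hom (\<lambda>c. proj (scal c) :: 'i::alg_ideal alg_quot) (\<lambda>g. proj (var g))"
proof (rule falg_hom.intro)
  fix c d g
  show "proj (scal (c + d)) = proj (scal c) + (proj (scal d) :: 'i alg_quot)"
    by (simp only: scal_add proj_simps)
  show "proj (scal (c * d)) = proj (scal c) * (proj (scal d) :: 'i alg_quot)"
    by (simp only: scal_mult proj_simps)
  show "proj (scal 1) = (1 :: 'i alg_quot)"
    by (simp only: scal_1 proj_simps)
  show "proj (scal c) * proj (var g) = proj (var g) * (proj (scal c) :: 'i alg_quot)"
    by (simp only: proj_simps(4)[symmetric] scal_central[of c "var g"])
qed

lemma proj_eq_eval: "proj f = eval (\<lambda>c. proj (scal c)) (\<lambda>g. proj (var g)) f"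
  by (rule falg_hom.hom_unique[OF falg_hom_proj, where X = UNIV and \<phi> = proj]) (simp_all add: proj_simps free_carrier_UNIV)

text \<open>Additivity is the one condition imposed, so that left multiplications, rescalings and
  skew derivations live in a single ring under composition.\<close>

typedef (overloaded) 'a endo = "{h :: 'a::ab_group_add \<Rightarrow> 'a. \<forall>x y. h (x + y) = h x + h y}"
  morphisms app Endo
  by (intro exI[of _ "\<lambda>x. x"]) simp

setup_lifting type_definition_endo

lemma app_add: "app h (x + y) = app h x + app h y"
  by transfer simp

lemma app_0: "app h 0 = 0"
  using app_add[of h 0 0] by simp

lemma app_uminus: "app h (- x) = - app h x"
  using app_add[of h x "- x"] by (simp add: app_0 eq_neg_iff_add_eq_0 add.commute)

lemma app_diff: "app h (x - y) = app h x - app h y"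
  using app_add[of h x "- y"] by (simp add: app_uminus)

instantiation endo :: (ab_group_add) "{ring, monoid_mult}"
begin

lift_definition zero_endo :: "'a endo" is "\<lambda>x. 0" by simp
lift_definition one_endo :: "'a endo" is "\<lambda>x. x" by simp
lift_definition uminus_endo :: "'a endo \<Rightarrow> 'a endo" is "\<lambda>h x. - h x" by simp
lift_definition plus_endo :: "'a endo \<Rightarrow> 'a endo \<Rightarrow> 'a endo" is "\<lambda>h k x. h x + k x"
  by (simp add: algebra_simps)
lift_definition minus_endo :: "'a endo \<Rightarrow> 'a endo \<Rightarrow> 'a endo" is "\<lambda>h k x. h x - k x"
  by (simp add: algebra_simps)
lift_definition times_endo :: "'a endo \<Rightarrow> 'a endo \<Rightarrow> 'a endo" is "\<lambda>h k x. h (k x)" by simp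

instance
  by standard (transfer, simp add: algebra_simps fun_eq_iff)+

end

lemma app_simps:
  "app 0 x = 0" "app 1 x = x" "app (- h) x = - app h x" "app (h + k) x = app h x + app k x"
  "app (h - k) x = app h x - app k x" "app (h * k) x = app h (app k x)"
  by (transfer, simp)+

lemma endo_eqI: "(\<And>x. app h x = app k x) \<Longrightarrow> h = k"
  by transfer auto

lift_definition left_mult :: "'r::ring \<Rightarrow> 'r endo" is "(*)"
  by (simp add: distrib_left)

lemma app_left_mult: "app (left_mult x) y = x * y"
  by (simp add: left_mult.rep_eq)

lemma left_mult_hom:
  "left_mult (x + y) = left_mult x + left_mult y" "left_mult (x * y) = left_mult x * left_mult y"
  "left_mult (1 :: 'r::{ring,monoid_mult}) = 1"
  by (rule endo_eqI; simp add: app_left_mult app_simps algebra_simps)+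

section \<open>Operators for the lower triangular representation\<close>

text \<open>\<open>col1_op\<close> and \<open>col2_op\<close> are left multiplication by \<open>t\<^sub>i\<^sub>1\<close> and \<open>t\<^sub>i\<^sub>2\<close> as seen by a quadruple
  \<open>(E x, A\<^sub>1 x, A\<^sub>2 x, B x)\<close>, where \<open>E, A\<^sub>1, A\<^sub>2\<close> are the operators of \<open>a\<^sub>2\<^sub>1, a\<^sub>1\<^sub>1, a\<^sub>2\<^sub>2\<close> and
  \<open>B\<close> is the inverse of \<open>A\<^sub>1 A\<^sub>2\<close>. The operators themselves are recovered from the orbit of
  \<open>(0, 1, 1, 1)\<close>, the quadruple of \<open>x = 1\<close>.\<close>

lift_definition diag4 :: "'r::ring \<Rightarrow> ('r \<times> 'r \<times> 'r \<times> 'r) endo" is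
  "\<lambda>c (x, y, z, u). (c * x, c * y, c * z, c * u)"
  by (auto simp: distrib_left)

lift_definition col1_op :: "'r::ring \<Rightarrow> 'r \<Rightarrow> 'r \<Rightarrow> 'r \<Rightarrow> ('r \<times> 'r \<times> 'r \<times> 'r) endo" is
  "\<lambda>q qi t1 t2 (x, y, z, u).
     (qi * (t1 * x) + (qi - q) * (t2 * y), t1 * y, qi * (t1 * z), q * (t1 * u))"
  by (auto simp: algebra_simps)

lift_definition col2_op :: "'r::ring \<Rightarrow> 'r \<Rightarrow> 'r \<Rightarrow> ('r \<times> 'r \<times> 'r \<times> 'r) endo" is
  "\<lambda>q qi t2 (x, y, z, u). (t2 * x, qi * (t2 * y), t2 * z, q * (t2 * u))"
  by (auto simp: algebra_simps)

lemmas app4_simps = diag4.rep_eq col1_op.rep_eq col2_op.rep_eq app_simps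

lemma zero_quad: "(0 :: 'a::zero \<times> 'b::zero \<times> 'c::zero \<times> 'd::zero) = (0, 0, 0, 0)"
  by (simp add: zero_prod_def)

lemma endo4_eqI: "(\<And>x y z u. app h (x, y, z, u) = app k (x, y, z, u)) \<Longrightarrow> h = k"
  by (rule endo_eqI) auto

context q_scalars
begin

text \<open>Together with \<open>qcomm_ops\<close> this gives the Manin relations for the operators
  on quadruples, so that their action descends from words to the two-column algebra.\<close>

lemma qrow_ops:
  assumes "qrow q qi p t1 t2" and c: "scalar_comm t1" "scalar_comm t2"
  shows "qrow (diag4 q) (diag4 qi) p (col1_op q qi t1 t2) (col2_op q qi t2)"
proof -
  note rules = scalar_comm_rules[OF c(1)] scalar_comm_rules[OF c(2)] q_rules algebra_simps zero_quad app4_simps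
  show ?thesis
  proof (cases p)
    case zero
    with assms have z: "qrow q qi 0 t1 t2" by simp
    have "col1_op q qi t1 t2 * col2_op q qi t2 = diag4 qi * (col2_op q qi t2 * col1_op q qi t1 t2)"
      by (rule endo4_eqI) (simp add: rules qrow_even_rules[OF z])
    then show ?thesis using zero by (simp add: qrow_def)
  next
    case one
    with assms have z: "qrow q qi 1 t1 t2" by simp
    have "col1_op q qi t1 t2 * col2_op q qi t2 = - (diag4 q * (col2_op q qi t2 * col1_op q qi t1 t2))"
      "col1_op q qi t1 t2 * col1_op q qi t1 t2 = 0" "col2_op q qi t2 * col2_op q qi t2 = 0"
      by (rule endo4_eqI; simp add: rules qrow_odd_rules[OF z])+
    then show ?thesis using one by (simp add: qrow_def)
  qed
qed

lemma qcomm_ops: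
  assumes ts: "qcomm q qi (ring_sign d e) t1 t2 s1 s2"
    and c: "scalar_comm t1" "scalar_comm t2" "scalar_comm s1" "scalar_comm s2"
  shows "qcomm (diag4 q) (diag4 qi) (ring_sign d e)
    (col1_op q qi t1 t2) (col2_op q qi t2) (col1_op q qi s1 s2) (col2_op q qi s2)"
proof -
  note rules = scalar_comm_rules[OF c(1)] scalar_comm_rules[OF c(2)] scalar_comm_rules[OF c(3)]
    scalar_comm_rules[OF c(4)] q_rules algebra_simps zero_quad app4_simps
  show ?thesis
  proof (cases "d = 1 \<and> e = 1")
    case True
    with ts have ts': "qcomm q qi (- 1) t1 t2 s1 s2" by (simp add: ring_sign_def)
    have "qcomm (diag4 q) (diag4 qi) (- 1)
        (col1_op q qi t1 t2) (col2_op q qi t2) (col1_op q qi s1 s2) (col2_op q qi s2)"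
      unfolding qcomm_def
      by (intro conjI; rule endo4_eqI; simp add: rules qcomm_minus_rules[OF ts'])
    then show ?thesis using True by (simp add: ring_sign_def)
  next
    case False
    with ts have ts': "qcomm q qi 1 t1 t2 s1 s2" by (auto simp: ring_sign_def)
    have "qcomm (diag4 q) (diag4 qi) 1
        (col1_op q qi t1 t2) (col2_op q qi t2) (col1_op q qi s1 s2) (col2_op q qi s2)"
      unfolding qcomm_def
      by (intro conjI; rule endo4_eqI; simp add: rules qcomm_rules[OF ts'])
    then show ?thesis using False by (auto simp: ring_sign_def)
  qed
qed

section \<open>The lower triangular representation over an arbitrary ring\<close>

context
  fixes A1 A2 E :: 'r
  assumes ops: "A1 * E = qi * (E * A1)" "A1 * A2 = A2 * A1" "E * A2 = qi * (A2 * E)"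
    and ops_comm: "scalar_comm A1" "scalar_comm A2" "scalar_comm E"
begin

text \<open>For \<open>t1\<close>, \<open>t2\<close> the left multiplications by the entries of a
  row, these are the rules by which the rescalings \<open>A1\<close>, \<open>A2\<close> and the skew
  derivation \<open>E\<close> pass a generator.\<close>

definition acts :: "'r \<Rightarrow> 'r \<Rightarrow> bool" where
  "acts t1 t2 \<longleftrightarrow> scalar_comm t1 \<and> scalar_comm t2 \<and>
     A1 * t1 = t1 * A1 \<and> A1 * t2 = qi * (t2 * A1) \<and>
     A2 * t1 = qi * (t1 * A2) \<and> A2 * t2 = t2 * A2 \<and>
     E * t1 = qi * (t1 * E) + (qi - q) * (t2 * A1) \<and> E * t2 = t2 * E"

lemma actsD:
  assumes "acts t1 t2"
  shows "scalar_comm t1" "scalar_comm t2"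
    "A1 * t1 = t1 * A1" "A1 * t2 = qi * (t2 * A1)" "A2 * t1 = qi * (t1 * A2)" "A2 * t2 = t2 * A2"
    "E * t1 = qi * (t1 * E) + (qi - q) * (t2 * A1)" "E * t2 = t2 * E"
  using assms by (simp_all add: acts_def)

lemmas acts_rules = actsD(3-) actsD(3-)[THEN assoc_eq] actsD(1)[THEN scalar_comm_rules(1)]
  actsD(1)[THEN scalar_comm_rules(2)] actsD(1)[THEN scalar_comm_rules(3)] actsD(1)[THEN scalar_comm_rules(4)]
  actsD(2)[THEN scalar_comm_rules(1)] actsD(2)[THEN scalar_comm_rules(2)]
  actsD(2)[THEN scalar_comm_rules(3)] actsD(2)[THEN scalar_comm_rules(4)]

text \<open>Normal ordering of operators: together with \<open>acts_rules\<close>, row entries move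
  to the left of the operators, which end up in the order \<open>A2\<close>, \<open>E\<close>,
  \<open>A1\<close>.\<close>

lemmas ops_rules = ops ops[THEN assoc_eq] ops_comm[THEN scalar_comm_rules(1)]
  ops_comm[THEN scalar_comm_rules(2)] ops_comm[THEN scalar_comm_rules(3)] ops_comm[THEN scalar_comm_rules(4)]
  q_rules algebra_simps

text \<open>The new row is the product of \<open>(t2, t1)\<close> with the triangular matrix whose
  rows are \<open>(A1, 0)\<close> and \<open>(E, A2)\<close>.\<close>

lemma qrow_acts:
  assumes t: "acts t1 t2" and "qrow q qi p t1 t2"
  shows "qrow q qi p (t2 * A1 + t1 * E) (t1 * A2)"
proof (cases p)
  case zero
  with assms have z: "qrow q qi 0 t1 t2" by simp
  show ?thesis using zero unfolding qrow_def
    by (simp add: ops_rules acts_rules[OF t] qrow_even_rules[OF z])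
next
  case one
  with assms have z: "qrow q qi 1 t1 t2" by simp
  show ?thesis using one unfolding qrow_def
    by (simp add: ops_rules acts_rules[OF t] qrow_odd_rules[OF z])
qed

lemma qcomm_acts_base:
  assumes t: "acts t1 t2"
  shows "qcomm q qi 1 A1 0 (t2 * A1 + t1 * E) (t1 * A2)" "qcomm q qi 1 E A2 (t2 * A1 + t1 * E) (t1 * A2)"
  unfolding qcomm_def by (simp_all add: ops_rules acts_rules[OF t])

lemma qcomm_acts:
  assumes t: "acts t1 t2" and s: "acts s1 s2" and ts: "qcomm q qi (ring_sign d e) t1 t2 s1 s2"
  shows "qcomm q qi (ring_sign d e) (t2 * A1 + t1 * E) (t1 * A2) (s2 * A1 + s1 * E) (s1 * A2)"
proof (cases "d = 1 \<and> e = 1")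
  case True
  with ts have ts': "qcomm q qi (- 1) t1 t2 s1 s2" by (simp add: ring_sign_def)
  show ?thesis using True unfolding qcomm_def ring_sign_def
    by (simp add: ops_rules acts_rules[OF t] acts_rules[OF s] qcomm_minus_rules[OF ts'])
next
  case False
  with ts have ts': "qcomm q qi 1 t1 t2 s1 s2" by (auto simp: ring_sign_def)
  have "qcomm q qi 1 (t2 * A1 + t1 * E) (t1 * A2) (s2 * A1 + s1 * E) (s1 * A2)"
    unfolding qcomm_def
    by (simp add: ops_rules acts_rules[OF t] acts_rules[OF s] qcomm_rules[OF ts'])
  then show ?thesis using False by (auto simp: ring_sign_def)
qed

text \<open>The triangular matrix has determinant \<open>A1 * A2\<close>, inverted by
  \<open>B\<close>. In the second minor the terms with \<open>E\<close> cancel and leave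
  \<open>- q * t2 * A1 * A2\<close>, which accounts for the factor \<open>- qi\<close>.\<close>

lemma minors_acts:
  assumes t: "acts t1 t2" and B: "A1 * (A2 * B) = 1"
  shows "qdet A1 0 (t2 * A1 + t1 * E) (t1 * A2) * B = t1"
    "- (qi * (qdet E A2 (t2 * A1 + t1 * E) (t1 * A2) * B)) = t2"
proof -
  have "qdet A1 0 (t2 * A1 + t1 * E) (t1 * A2) = t1 * (A1 * A2)"
    unfolding qdet_def by (simp add: ops_rules acts_rules[OF t])
  then show "qdet A1 0 (t2 * A1 + t1 * E) (t1 * A2) * B = t1" by (simp add: mult.assoc B)
  have "- (qi * qdet E A2 (t2 * A1 + t1 * E) (t1 * A2)) = t2 * (A1 * A2)"
    unfolding qdet_def by (simp add: ops_rules acts_rules[OF t])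
  then have "- (qi * qdet E A2 (t2 * A1 + t1 * E) (t1 * A2)) * B = t2" by (simp add: mult.assoc B)
  then show "- (qi * (qdet E A2 (t2 * A1 + t1 * E) (t1 * A2) * B)) = t2" by (simp add: mult.assoc)
qed

end

end

section \<open>The homomorphism on the quantum superspace\<close>

lemma scal_left_commute: "f * (scal c * g) = scal c * (f * g)"
  by (simp only: mult.assoc[symmetric] scal_central[of c f])

text \<open>Sending the generators outside \<open>X\<close> to zero extends an ideal of the free algebra on \<open>X\<close> to one
  of the free algebra on all generators, without changing the quotient.\<close>

definition restrict_gens :: "gen set \<Rightarrow> gen \<Rightarrow> gen falg" where
  "restrict_gens X g = (if g \<in> X then var g else 0)"

lemma restrict_gens_closed: "Y \<subseteq> X \<Longrightarrow> restrict_gens Y g \<in> free_carrier X"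
  by (auto simp: restrict_gens_def)

lemma subst_restrict_gens: "f \<in> free_carrier X \<Longrightarrow> subst (restrict_gens X) f = f"
  by (erule subst_ident) (simp add: restrict_gens_def)

lemma two_sided_vimage:
  assumes "two_sided X J" "\<And>g. s g \<in> free_carrier X"
  shows "two_sided UNIV {f. subst s f \<in> J}"
proof -
  have "subst s f \<in> free_carrier X" for f
    by (rule subst_closed[of _ UNIV]) (simp_all add: free_carrier_UNIV assms(2))
  with two_sidedD[OF assms(1)] show ?thesis
    by (auto simp: two_sided_def free_carrier_UNIV subst_simps)
qed

lemma manin_relations_mono: "J \<subseteq> J' \<Longrightarrow> manin_relations I J pr pc \<subseteq> manin_relations I J' pr pc"
  unfolding manin_relations_def Let_def by (intro Un_mono; blast)

lemma manin_relations_closed: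
  assumes "\<And>i j. i \<in> I \<Longrightarrow> j \<in> J \<Longrightarrow> Entry i j \<in> X"
  shows "manin_relations I J pr pc \<subseteq> free_carrier X"
  using assms unfolding manin_relations_def Let_def by auto

text \<open>All monomials of a Manin relation have the same parity. This includes
  \<open>a_kj a_il\<close>, because the parity of an entry is the sum of its row and column
  parities.\<close>

lemma parity_aut_manin:
  assumes "r \<in> manin_relations I J pr pc"
  shows "\<exists>c. parity_aut (gen_parity pr pc) r = scal c * r"
proof -
  let ?s = "\<lambda>i j. parity_sign (entry_parity pr pc i j)"
  have two: "parity_aut (gen_parity pr pc) (ent i j * ent k l) = scal (?s i j * ?s k l) * (ent i j * ent k l)"
    for i j k l
    by (simp only: parity_aut_simps gen_parity.simps mult.assoc scal_mult scal_left_commute[of "ent i j"])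
  have *: "parity_aut (gen_parity pr pc) (m - scal c * m') = scal d * (m - scal c * m')"
    if "parity_aut (gen_parity pr pc) m = scal d * m" "parity_aut (gen_parity pr pc) m' = scal d * m'"
    for m m' c d
    using that by (simp add: parity_aut_simps right_diff_distrib scal_left_commute[of "scal d" c])
  have exch: "?s k j * ?s i l = ?s i j * ?s k l" for i j k l
    by (simp only: entry_parity_def parity_sign_add mult_ac)
  consider
      i j where "r = ent i j * ent i j"
    | i j k l c where "r = ent i j * ent k l - scal c * (ent k l * ent i j)"
    | i j k l c c' where "r = ent i j * ent k l - scal c * (ent k l * ent i j) - scal c' * (ent k j * ent i l)"
    using assms unfolding manin_relations_def Let_def by blast
  then show ?thesis
  proof cases
    case 1
    then show ?thesis using two by blast
  next
    case (2 i j k l c)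
    then show ?thesis using *[OF two[of i j k l], of _ c] two[of k l i j] by (auto simp: mult.commute)
  next
    case (3 i j k l c c')
    let ?d = "?s i j * ?s k l"
    have "parity_aut (gen_parity pr pc) (ent i j * ent k l - scal c * (ent k l * ent i j)) =
        scal ?d * (ent i j * ent k l - scal c * (ent k l * ent i j))"
      by (rule *[OF two]) (simp only: two[of k l i j] mult.commute)
    from *[OF this, of "ent k j * ent i l" c'] show ?thesis
      unfolding 3 two[of k j i l] exch[of k j i l] by blast
  qed
qed

section \<open>The two presentations: closure and stability under parity\<close>

definition mat_gens :: "gen set" where
  "mat_gens = {Entry i j | i j. i \<in> {1..4} \<and> j \<in> {1, 2}}"

lemma mat_gens_subset: "mat_gens \<subseteq> Mq22_gens"
  by (auto simp: mat_gens_def Mq22_gens_def)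

abbreviation Mq22_ideal :: "gen falg set" where
  "Mq22_ideal \<equiv> Idl\<^bsub>free_salgebra Mq22_gens (gen_parity matrix_parity matrix_parity)\<^esub> Mq22_rels"

abbreviation S_ideal :: "gen falg set" where
  "S_ideal \<equiv> Idl\<^bsub>free_salgebra S_gens S_parity\<^esub> S_rels"

lemma Mq22_rels_closed: "Mq22_rels \<subseteq> free_carrier Mq22_gens"
  unfolding Mq22_rels_def by (rule manin_relations_closed) (auto simp: Mq22_gens_def)

lemma minor_closed: "r \<in> {1..6} \<Longrightarrow> s \<in> {1..6} \<Longrightarrow> minor r s \<in> free_carrier S_gens"
  by (auto simp: minor_def S_gens_def)

lemma Dinv_closed: "var Dinv \<in> free_carrier S_gens"
  by (auto simp: S_gens_def)

lemma S_rels_closed: "S_rels \<subseteq> free_carrier S_gens"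
proof -
  have "manin_relations {1..6} {1, 2} S_row_parity (\<lambda>_. 0) \<subseteq> free_carrier S_gens"
    by (rule manin_relations_closed) (auto simp: S_gens_def)
  then show ?thesis using minor_closed[of 1 2] Dinv_closed by (auto simp: S_rels_def)
qed

lemma parity_aut_minor:
  "parity_aut S_parity (minor r s) = scal (parity_sign (S_row_parity r + S_row_parity s)) * minor r s"
proof -
  have two: "parity_aut S_parity (ent i j * ent k l) =
      scal (parity_sign (S_row_parity i + S_row_parity k)) * (ent i j * ent k l)" for i j k l
    by (simp only: parity_aut_simps S_parity_def gen_parity.simps entry_parity_def parity_sign_add
        add_0_right mult.assoc scal_mult scal_left_commute[of "ent i j"])
  show ?thesis
    unfolding minor_def parity_aut_simps(2) parity_aut_simps(3)[of _ "scal _"] parity_aut_simps(4) two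
    by (simp add: right_diff_distrib scal_left_commute[of "scal qinv"])
qed

lemma S_stable:
  assumes "r \<in> S_rels"
  shows "parity_aut S_parity r \<in> S_ideal"
proof -
  have "\<exists>c. parity_aut S_parity r = scal c * r"
  proof (cases "r \<in> manin_relations {1..6} {1, 2} S_row_parity (\<lambda>_. 0)")
    case True
    then show ?thesis using parity_aut_manin unfolding S_parity_def by blast
  next
    case False
    \<comment> \<open>The rows 1 and 2 are even and so is \<open>Dinv\<close>, hence both inversion
      relations are fixed by the involution.\<close>
    have "parity_aut S_parity (minor 1 2) = minor 1 2"
      by (simp add: parity_aut_minor S_row_parity_def)
    then have "parity_aut S_parity r = scal 1 * r"
      using assms False by (auto simp: S_rels_def parity_aut_simps) (simp_all add: S_parity_def)
    then show ?thesis by blast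
  qed
  moreover have "r \<in> S_ideal" using assms subset_Idl[OF S_rels_closed] by blast
  ultimately show ?thesis using two_sidedD(8)[OF two_sided_Idl[OF S_rels_closed]] by metis
qed

lemma Mq22_stable:
  assumes "r \<in> Mq22_rels"
  shows "parity_aut (gen_parity matrix_parity matrix_parity) r \<in> Mq22_ideal"
proof -
  have "r \<in> Mq22_ideal" using assms subset_Idl[OF Mq22_rels_closed] by blast
  moreover obtain c where "parity_aut (gen_parity matrix_parity matrix_parity) r = scal c * r"
    using assms parity_aut_manin unfolding Mq22_rels_def by blast
  ultimately show ?thesis using two_sidedD(8)[OF two_sided_Idl[OF Mq22_rels_closed]] by simp
qed

section \<open>Quotient rings of the two presentations\<close>

datatype mat_index = Mat_Index
datatype mink_index = Mink_Index

instantiation mat_index :: alg_ideal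
begin

text \<open>Restriction to \<open>mat_gens\<close> makes the quotient a copy of the subalgebra of
  \<open>Mq22\<close> generated by the first two columns.\<close>

definition alg_ideal_mat_index :: "mat_index itself \<Rightarrow> gen falg set" where
  "alg_ideal_mat_index _ = {f. subst (restrict_gens mat_gens) f \<in> Mq22_ideal}"

instance
  by standard (auto simp: alg_ideal_mat_index_def
      intro!: two_sided_vimage[OF two_sided_Idl[OF Mq22_rels_closed]] restrict_gens_closed[OF mat_gens_subset])

end

instantiation mink_index :: alg_ideal
begin

definition alg_ideal_mink_index :: "mink_index itself \<Rightarrow> gen falg set" where
  "alg_ideal_mink_index _ = {f. subst (restrict_gens S_gens) f \<in> S_ideal}"

instance
  by standard (auto simp: alg_ideal_mink_index_def
      intro!: two_sided_vimage[OF two_sided_Idl[OF S_rels_closed]] restrict_gens_closed[OF subset_refl])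

end

lemma proj_mat_eq_0_iff:
  "f \<in> free_carrier mat_gens \<Longrightarrow> (proj f :: mat_index alg_quot) = 0 \<longleftrightarrow> f \<in> Mq22_ideal"
  by (simp add: proj_eq_0_iff alg_ideal_mat_index_def subst_restrict_gens)

lemma proj_mink_eq_0_iff:
  "f \<in> free_carrier S_gens \<Longrightarrow> (proj f :: mink_index alg_quot) = 0 \<longleftrightarrow> f \<in> S_ideal"
  by (simp add: proj_eq_0_iff alg_ideal_mink_index_def subst_restrict_gens)

lemma proj_mat_other:
  assumes "g \<notin> mat_gens"
  shows "(proj (var g) :: mat_index alg_quot) = 0"
proof -
  have "0 \<in> Mq22_ideal" by (rule two_sidedD(2)[OF two_sided_Idl[OF Mq22_rels_closed]])
  with assms show ?thesis by (simp add: proj_eq_0_iff alg_ideal_mat_index_def restrict_gens_def)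
qed

text \<open>Rows are shifted by 2 and columns exchanged: by \<open>qrow_qdet\<close>,
  \<open>D_1i\<close> and \<open>D_2i\<close> obey the relations of a row in this order, whereas the
  first superspace column is built from \<open>D_2i\<close>.\<close>

fun mink_poly :: "gen \<Rightarrow> gen falg" where
  "mink_poly (Entry i j) = (if j = 1 then minor 1 (i + 2) * var Dinv
     else scal (- qinv) * (minor 2 (i + 2) * var Dinv))"
| "mink_poly Dinv = 0"

lemma mink_poly_closed: "g \<in> mat_gens \<Longrightarrow> mink_poly g \<in> free_carrier S_gens"
  by (auto simp: mat_gens_def minor_closed Dinv_closed)

lemma parity_aut_mink_poly:
  assumes "g \<in> mat_gens"
  shows "parity_aut S_parity (mink_poly g) =
    scal (parity_sign (gen_parity matrix_parity matrix_parity g)) * mink_poly g"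
proof -
  have par: "S_row_parity (Suc (Suc i)) = matrix_parity i" for i
    by (simp add: S_row_parity_def matrix_parity_def)
  have zero: "S_row_parity (Suc 0) = 0" "S_row_parity 2 = 0" "matrix_parity (Suc 0) = 0" "matrix_parity 2 = 0"
    by (simp_all add: S_row_parity_def matrix_parity_def)
  have D: "parity_aut S_parity (var Dinv) = var Dinv"
    by (simp add: parity_aut_simps S_parity_def)
  show ?thesis
    using assms by (auto simp: mat_gens_def parity_aut_simps(3,4) parity_aut_minor par zero entry_parity_def D
      scal_left_commute[of "scal (- qinv)"] mult.assoc)
qed

lemma two_col_mink:
  "q_scalars.two_col (proj (scal qvar)) (proj (scal qinv)) {1..4} matrix_parity
     (\<lambda>i j. proj (mink_poly (Entry i j)) :: mink_index alg_quot)"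
proof -
  let ?p = "proj :: gen falg \<Rightarrow> mink_index alg_quot"
  interpret falg_hom "\<lambda>c. ?p (scal c)" "\<lambda>g. ?p (var g)" by (rule falg_hom_proj)
  have rel: "?p r = 0" if "r \<in> S_rels" for r
    using that subset_Idl[OF S_rels_closed] S_rels_closed proj_mink_eq_0_iff by blast
  have a: "two_col {1..6} S_row_parity (\<lambda>i j. ?p (ent i j))"
    by (rule two_colI_manin[OF falg_hom_proj, where pc = "\<lambda>_. 0"])
      (simp_all add: rel S_rels_def flip: proj_eq_eval)
  have minor: "?p (minor r s) = qdet (?p (ent r 1)) (?p (ent r 2)) (?p (ent s 1)) (?p (ent s 2))" for r s
    by (simp add: minor_def qdet_def proj_simps)
  have inv: "?p (minor 1 2) * ?p (var Dinv) = 1" "?p (var Dinv) * ?p (minor 1 2) = 1"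
    using rel[of "minor 1 2 * var Dinv - 1"] rel[of "var Dinv * minor 1 2 - 1"]
    by (simp_all add: S_rels_def proj_simps)
  have shift: "Suc (Suc (i - 2)) = i" if "3 \<le> i" for i :: nat
    using that by simp
  have b: "two_col {3..6} S_row_parity (\<lambda>i j. ?p (mink_poly (Entry (i - 2) j)))"
    by (rule two_col_minors[OF a _ _ _ inv[unfolded minor]])
      (simp_all add: S_row_parity_def scalar_comm_var minor scal_uminus proj_simps shift)
  have par: "S_row_parity (Suc (Suc i)) = matrix_parity i" for i
    by (simp add: S_row_parity_def matrix_parity_def)
  show ?thesis
    unfolding two_col_def
  proof (intro conjI ballI impI)
    fix i :: nat assume "i \<in> {1..4}"
    then show "qrow (?p (scal qvar)) (?p (scal qinv)) (matrix_parity i)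
        (?p (mink_poly (Entry i 1))) (?p (mink_poly (Entry i 2)))"
      using two_colD(1)[OF b, of "i + 2"] by (simp add: par)
  next
    fix i k :: nat assume "i \<in> {1..4}" "k \<in> {1..4}" "i < k"
    then show "qcomm (?p (scal qvar)) (?p (scal qinv)) (ring_sign (matrix_parity i) (matrix_parity k))
        (?p (mink_poly (Entry i 1))) (?p (mink_poly (Entry i 2)))
        (?p (mink_poly (Entry k 1))) (?p (mink_poly (Entry k 2)))"
      using two_colD(2)[OF b, of "i + 2" "k + 2"] by (simp add: par)
  qed
qed

lemma subst_mink_poly_mem:
  assumes f: "f \<in> free_carrier mat_gens" and "f \<in> Mq22_ideal"
  shows "subst mink_poly f \<in> S_ideal"
proof -
  let ?p = "proj :: gen falg \<Rightarrow> mink_index alg_quot"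
  \<comment> \<open>Columns 3 and 4 go to zero, so that \<open>v\<close> kills every relation of the
    full \<open>Mq22\<close> and not merely those among the first two columns.\<close>
  define v where "v g = (if g \<in> mat_gens then ?p (mink_poly g) else 0)" for g
  interpret P: falg_hom "\<lambda>c. ?p (scal c)" "\<lambda>g. ?p (var g)" by (rule falg_hom_proj)
  have hom: "falg_hom (\<lambda>c. ?p (scal c)) v"
  proof (rule falg_hom.intro)
    show "?p (scal c) * v g = v g * ?p (scal c)" for c g
      by (simp add: v_def scal_central[of c] flip: proj_simps(4))
  qed (rule P.scalar_add P.scalar_mult P.scalar_one)+
  interpret V: falg_hom "\<lambda>c. ?p (scal c)" v by (rule hom)
  have "eval (\<lambda>c. ?p (scal c)) v r = 0" if "r \<in> Mq22_rels" for r
  proof (rule eval_manin_relations[OF hom _ _ _ _ _ that[unfolded Mq22_rels_def]])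
    show "P.two_col {1..4} matrix_parity (\<lambda>i j. v (Entry i j))"
      using two_col_mink by (simp add: P.two_col_def v_def mat_gens_def)
  qed (auto simp: matrix_parity_def v_def mat_gens_def)
  then have "eval (\<lambda>c. ?p (scal c)) v f = 0"
    using eval_Idl[OF Mq22_rels_closed hom] assms(2) by blast
  moreover have "eval (\<lambda>c. ?p (scal c)) v f = ?p (subst mink_poly f)"
    unfolding proj_eq_eval[of "subst mink_poly f"]
    by (rule eval_subst[OF falg_hom_proj hom f, symmetric]) (simp add: v_def flip: proj_eq_eval)
  ultimately show ?thesis
    using proj_mink_eq_0_iff[OF subst_closed[OF f mink_poly_closed]] by simp
qed

section \<open>Left multiplication and skew derivations on the quantum matrix algebra\<close>

type_synonym mat_ring = "mat_index alg_quot"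

abbreviation qscal :: "laurent \<Rightarrow> mat_ring" where
  "qscal c \<equiv> proj (scal c)"

abbreviation tgen :: "nat \<Rightarrow> nat \<Rightarrow> mat_ring" where
  "tgen i j \<equiv> proj (ent i j)"

interpretation T: falg_hom qscal "\<lambda>g. proj (var g) :: mat_ring"
  by (rule falg_hom_proj)

lemma qscal_central: "qscal c * x = x * qscal c"
proof -
  obtain f where "x = proj f" using proj_surj by blast
  then show ?thesis by (simp add: scal_central[of c f] flip: proj_simps(4))
qed

lemma mat_ring_scalar_comm: "T.scalar_comm x"
  by (simp add: T.scalar_comm_def qscal_central)

lemma two_col_tgen: "T.two_col {1..4} matrix_parity tgen"
proof (rule two_colI_manin[OF falg_hom_proj, where pc = matrix_parity])
  fix r assume r: "r \<in> manin_relations {1..4} {1, 2} matrix_parity matrix_parity"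
  have "manin_relations {1..4} {1, 2} matrix_parity matrix_parity \<subseteq> Mq22_rels"
    unfolding Mq22_rels_def by (rule manin_relations_mono) auto
  with r have "r \<in> Mq22_ideal"
    using subset_Idl[OF Mq22_rels_closed] by blast
  moreover have "r \<in> free_carrier mat_gens"
    using r manin_relations_closed[of "{1..4}" "{1, 2}" mat_gens] by (auto simp: mat_gens_def)
  ultimately show "eval qscal (\<lambda>g. proj (var g)) r = (0 :: mat_ring)"
    by (simp add: proj_mat_eq_0_iff flip: proj_eq_eval)
qed (simp_all add: matrix_parity_def)

lemma mat_ring_induct [case_names scal gen add]:
  assumes "\<And>c. P (qscal c)" "\<And>i x. P x \<Longrightarrow> P (tgen i 1 * x)" "\<And>i x. P x \<Longrightarrow> P (tgen i 2 * x)"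
    "\<And>x y. P x \<Longrightarrow> P y \<Longrightarrow> P (x + y)"
  shows "P x"
proof -
  obtain f where x: "x = proj f" using proj_surj by blast
  have "f \<in> free_carrier UNIV" by (simp add: free_carrier_UNIV)
  then have "P (proj f)"
  proof (induction f rule: free_carrier_induct)
    case (var g f)
    show ?case
    proof (cases "g \<in> mat_gens")
      case True
      with var assms(2,3) show ?thesis by (auto simp: mat_gens_def proj_simps(4))
    next
      case False
      then have "proj (var g * f) = qscal 0" by (simp add: proj_simps(4,6) proj_mat_other)
      then show ?thesis by (simp only: assms(1))
    qed
  qed (simp_all add: assms proj_simps)
  with x show ?thesis by simp
qed

fun quad_gen :: "gen \<Rightarrow> (mat_ring \<times> mat_ring \<times> mat_ring \<times> mat_ring) endo" where
  "quad_gen (Entry i j) =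
     (if j = 1 then col1_op (qscal qvar) (qscal qinv) (tgen i 1) (tgen i 2)
      else if j = 2 then col2_op (qscal qvar) (qscal qinv) (tgen i 2) else 0)"
| "quad_gen Dinv = 0"

definition quad_rep :: "gen falg \<Rightarrow> (mat_ring \<times> mat_ring \<times> mat_ring \<times> mat_ring) endo" where
  "quad_rep = eval (\<lambda>c. diag4 (qscal c)) quad_gen"

lemma qscal_left_commute: "x * (qscal c * y) = qscal c * (x * y)"
  by (simp only: mult.assoc[symmetric] qscal_central[of c x])

interpretation Q4: falg_hom "\<lambda>c. diag4 (qscal c)" quad_gen
proof
  fix c d :: laurent and g
  show "diag4 (qscal (c + d)) = diag4 (qscal c) + diag4 (qscal d)"
    by (rule endo4_eqI) (simp add: app4_simps scal_add proj_simps algebra_simps)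
  show "diag4 (qscal (c * d)) = diag4 (qscal c) * diag4 (qscal d)"
    by (rule endo4_eqI) (simp add: app4_simps scal_mult proj_simps mult.assoc)
  show "diag4 (qscal 1) = 1"
    by (rule endo4_eqI) (simp add: app4_simps proj_simps)
  show "diag4 (qscal c) * quad_gen g = quad_gen g * diag4 (qscal c)"
    by (cases g) (auto intro!: endo4_eqI simp: app4_simps zero_quad algebra_simps
        qscal_left_commute[of "qscal qvar" c] qscal_left_commute[of "qscal qinv" c]
        qscal_left_commute[of "tgen _ _" c])
qed

text \<open>The operators satisfy the relations of \<open>Mq22\<close> with columns 3 and 4 sent to
  zero, so \<open>quad_rep\<close> depends only on the class in \<open>mat_ring\<close>.\<close>

lemma quad_rep_cong:
  assumes "(proj f :: mat_ring) = proj g"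
  shows "quad_rep f = quad_rep g"
proof -
  have two_col: "Q4.two_col {1..4} matrix_parity (\<lambda>i j. quad_gen (Entry i j))"
    using two_col_tgen
    by (auto simp: T.two_col_def Q4.two_col_def intro!: T.qrow_ops T.qcomm_ops mat_ring_scalar_comm)
  have "eval (\<lambda>c. diag4 (qscal c)) quad_gen r = 0" if "r \<in> Mq22_rels" for r
    by (rule eval_manin_relations[OF Q4.falg_hom_axioms two_col _ _ _ _ that[unfolded Mq22_rels_def]])
      (auto simp: matrix_parity_def)
  then have van: "quad_rep h = 0" if "h \<in> Mq22_ideal" for h
    unfolding quad_rep_def using eval_Idl[OF Mq22_rels_closed Q4.falg_hom_axioms] that by blast
  have "quad_gen g = 0" if "g \<notin> mat_gens" for g
  proof (cases g)
    case (Entry i j)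
    \<comment> \<open>Rows outside \<open>1..4\<close> are zero in \<open>mat_ring\<close>, and
      their operators vanish with them.\<close>
    have "tgen i j = 0" if "j \<in> {1, 2}" "\<not> i \<in> {1..4}" for j
      using that by (intro proj_mat_other) (auto simp: mat_gens_def)
    then show ?thesis using that Entry
      by (auto simp: mat_gens_def zero_quad app4_simps intro!: endo4_eqI)
  qed simp
  then have "quad_rep (subst (restrict_gens mat_gens) h) = quad_rep h" for h
    unfolding quad_rep_def
    by (intro eval_subst[OF Q4.falg_hom_axioms Q4.falg_hom_axioms, of h UNIV])
      (auto simp: restrict_gens_def free_carrier_UNIV)
  moreover have "subst (restrict_gens mat_gens) (f - g) \<in> Mq22_ideal"
    using assms proj_eq_0_iff[where 'i = mat_index, of "f - g"]
    by (simp add: proj_simps alg_ideal_mat_index_def)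
  ultimately have "quad_rep (f - g) = 0" using van by metis
  then show ?thesis unfolding quad_rep_def by (simp add: Q4.eval_diff)
qed

definition quad :: "mat_ring \<Rightarrow> mat_ring \<times> mat_ring \<times> mat_ring \<times> mat_ring" where
  "quad x = app (quad_rep (SOME f. proj f = x)) (0, 1, 1, 1)"

lemma quad_proj: "quad (proj f) = app (quad_rep f) (0, 1, 1, 1)"
proof -
  have "(proj (SOME g. (proj g :: mat_ring) = proj f) :: mat_ring) = proj f"
    by (rule someI) (rule refl)
  from quad_rep_cong[OF this] show ?thesis by (simp add: quad_def)
qed

lemma quad_simps:
  "quad (x + y) = quad x + quad y"
  "quad (tgen i 1 * x) = app (quad_gen (Entry i 1)) (quad x)"
  "quad (tgen i 2 * x) = app (quad_gen (Entry i 2)) (quad x)"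
  "quad (qscal c * x) = app (diag4 (qscal c)) (quad x)"
  "quad 1 = (0, 1, 1, 1)"
proof -
  obtain f g where x: "x = proj f" "y = proj g" using proj_surj by metis
  show "quad (x + y) = quad x + quad y"
    unfolding x proj_simps(1)[symmetric] quad_proj by (simp add: quad_rep_def Q4.eval_add app_simps)
  show "quad (tgen i 1 * x) = app (quad_gen (Entry i 1)) (quad x)"
    "quad (tgen i 2 * x) = app (quad_gen (Entry i 2)) (quad x)"
    "quad (qscal c * x) = app (diag4 (qscal c)) (quad x)"
    unfolding x proj_simps(4)[symmetric] quad_proj
    by (simp_all only: quad_rep_def Q4.eval_mult Q4.eval_var Q4.eval_scal app_simps)
  show "quad 1 = (0, 1, 1, 1)"
    unfolding proj_simps(5)[symmetric] quad_proj by (simp add: quad_rep_def app_simps)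
qed

section \<open>The rescaling operators and the skew derivation\<close>

lift_definition op_E :: "mat_ring endo" is "\<lambda>x. fst (quad x)"
  by (simp add: quad_simps(1))
lift_definition op_A1 :: "mat_ring endo" is "\<lambda>x. fst (snd (quad x))"
  by (simp add: quad_simps(1))
lift_definition op_A2 :: "mat_ring endo" is "\<lambda>x. fst (snd (snd (quad x)))"
  by (simp add: quad_simps(1))
lift_definition op_B :: "mat_ring endo" is "\<lambda>x. snd (snd (snd (quad x)))"
  by (simp add: quad_simps(1))

lemma app_ops_quad: "quad x = (app op_E x, app op_A1 x, app op_A2 x, app op_B x)"
  by (simp add: op_E.rep_eq op_A1.rep_eq op_A2.rep_eq op_B.rep_eq)

lemma app_ops:
  "app op_E (tgen i 1 * x) = qscal qinv * (tgen i 1 * app op_E x)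
     + (qscal qinv - qscal qvar) * (tgen i 2 * app op_A1 x)"
  "app op_A1 (tgen i 1 * x) = tgen i 1 * app op_A1 x"
  "app op_A2 (tgen i 1 * x) = qscal qinv * (tgen i 1 * app op_A2 x)"
  "app op_B (tgen i 1 * x) = qscal qvar * (tgen i 1 * app op_B x)"
  "app op_E (tgen i 2 * x) = tgen i 2 * app op_E x"
  "app op_A1 (tgen i 2 * x) = qscal qinv * (tgen i 2 * app op_A1 x)"
  "app op_A2 (tgen i 2 * x) = tgen i 2 * app op_A2 x"
  "app op_B (tgen i 2 * x) = qscal qvar * (tgen i 2 * app op_B x)"
  using quad_simps(2)[of i x] quad_simps(3)[of i x] unfolding app_ops_quad by (simp_all add: app4_simps)

lemma app_ops_scal:
  "app op_E (qscal c * x) = qscal c * app op_E x" "app op_A1 (qscal c * x) = qscal c * app op_A1 x"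
  "app op_A2 (qscal c * x) = qscal c * app op_A2 x" "app op_B (qscal c * x) = qscal c * app op_B x"
  using quad_simps(4)[of c x] unfolding app_ops_quad by (simp_all add: app4_simps)

lemma app_ops_1:
  "app op_E 1 = 0" "app op_A1 1 = 1" "app op_A2 1 = 1" "app op_B 1 = 1"
  using quad_simps(5) unfolding app_ops_quad by simp_all

lemma app_ops_scalar:
  "app op_E (qscal c) = 0" "app op_A1 (qscal c) = qscal c" "app op_A2 (qscal c) = qscal c"
  "app op_B (qscal c) = qscal c"
  using app_ops_scal[of c 1] by (simp_all add: app_ops_1)

lemmas app_ops_rules = app_simps app_ops[unfolded One_nat_def] app_ops_scal app_ops_scalar app_left_mult app_add app_diff app_0
  T.q_rules algebra_simps qscal_left_commute[of "tgen _ _"] qscal_left_commute[of "qscal qvar" qinv]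

text \<open>Identities between operators hold on scalars and propagate along left multiplication by
  generators, which \<open>app_ops\<close> pulls out of both sides.\<close>

lemma op_A1_A2: "op_A1 * op_A2 = op_A2 * op_A1"
proof (rule endo_eqI)
  show "app (op_A1 * op_A2) x = app (op_A2 * op_A1) x" for x
    by (induction x rule: mat_ring_induct) (simp_all add: app_ops_rules)
qed

lemma op_A1_E: "op_A1 * op_E = left_mult (qscal qinv) * (op_E * op_A1)"
proof (rule endo_eqI)
  show "app (op_A1 * op_E) x = app (left_mult (qscal qinv) * (op_E * op_A1)) x" for x
    by (induction x rule: mat_ring_induct) (simp_all add: app_ops_rules)
qed

lemma op_E_A2: "op_E * op_A2 = left_mult (qscal qinv) * (op_A2 * op_E)"
proof (rule endo_eqI)
  \<comment> \<open>Passing \<open>tgen i 1\<close> creates a term in \<open>tgen i 2\<close> that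
    contains \<open>A1 * A2\<close> on one side and \<open>A2 * A1\<close> on the other.\<close>
  have "app op_A1 (app op_A2 x) = app op_A2 (app op_A1 x)" for x
    using arg_cong[OF op_A1_A2, of "\<lambda>h. app h x"] by (simp add: app_simps)
  then show "app (op_E * op_A2) x = app (left_mult (qscal qinv) * (op_A2 * op_E)) x" for x
    by (induction x rule: mat_ring_induct) (simp_all add: app_ops_rules)
qed

text \<open>On passing a generator of either column, \<open>A1 * A2\<close> contributes the factor
  \<open>q^-1\<close> and \<open>B\<close> the factor \<open>q\<close>.\<close>

lemma op_B_inverse: "op_A1 * (op_A2 * op_B) = 1" "op_B * (op_A1 * op_A2) = 1"
proof -
  have "app (op_A1 * (op_A2 * op_B)) x = app 1 x" for x
    by (induction x rule: mat_ring_induct) (simp_all add: app_ops_rules)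
  moreover have "app (op_B * (op_A1 * op_A2)) x = app 1 x" for x
    by (induction x rule: mat_ring_induct) (simp_all add: app_ops_rules)
  ultimately show "op_A1 * (op_A2 * op_B) = 1" "op_B * (op_A1 * op_A2) = 1"
    by (auto intro: endo_eqI)
qed

section \<open>Faithfulness\<close>

text \<open>The first two rows form the lower triangular block, every later row is
  \<open>(t2, t1)\<close> times this block, and \<open>Dinv\<close> acts by the inverse
  \<open>op_B\<close> of its determinant.\<close>

fun mink_op :: "gen \<Rightarrow> mat_ring endo" where
  "mink_op (Entry i j) =
     (if i = 1 then (if j = 1 then op_A1 else 0)
      else if i = 2 then (if j = 1 then op_E else op_A2)
      else if j = 1 then left_mult (tgen (i - 2) 2) * op_A1 + left_mult (tgen (i - 2) 1) * op_E
      else left_mult (tgen (i - 2) 1) * op_A2)"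
| "mink_op Dinv = op_B"

interpretation L: falg_hom "\<lambda>c. left_mult (qscal c)" "\<lambda>g. left_mult (proj (var g))"
proof
  show "left_mult (qscal c) * left_mult (proj (var g)) = left_mult (proj (var g)) * left_mult (qscal c)" for c g
    by (simp only: left_mult_hom(2)[symmetric] qscal_central[of c "proj (var g)"])
qed (simp_all only: scal_add scal_mult scal_1 proj_simps left_mult_hom)

interpretation M: falg_hom "\<lambda>c. left_mult (qscal c)" mink_op
proof
  fix c and g
  show "left_mult (qscal c) * mink_op g = mink_op g * left_mult (qscal c)"
    by (cases g) (auto intro!: endo_eqI simp: app_simps app_left_mult app_ops_scal distrib_left
        qscal_left_commute[of "tgen _ _" c])
qed (fact L.scalar_add L.scalar_mult L.scalar_one)+

lemma endo_scalar_comm: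
  "L.scalar_comm op_A1" "L.scalar_comm op_A2" "L.scalar_comm op_E" "L.scalar_comm (left_mult x)"
  unfolding L.scalar_comm_def
  by (auto intro!: endo_eqI simp: app_simps app_left_mult app_ops_scal qscal_left_commute[of x])

lemma acts_tgen: "L.acts op_A1 op_A2 op_E (left_mult (tgen i 1)) (left_mult (tgen i 2))"
  unfolding L.acts_def[OF op_A1_E op_A1_A2 op_E_A2 endo_scalar_comm(1-3)]
  by (auto intro!: endo_eqI endo_scalar_comm
      simp: app_simps app_left_mult app_ops[unfolded One_nat_def] algebra_simps)

lemma left_mult_simps:
  "left_mult (0 :: 'r::{ring,monoid_mult}) = 0" "left_mult (- x) = - left_mult x"
  "left_mult (x - y) = left_mult x - left_mult y"
  "left_mult (ring_sign d e :: 'r) = ring_sign d e"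
proof -
  show minus: "left_mult (- x) = - left_mult x"
    by (rule endo_eqI) (simp add: app_simps app_left_mult)
  show "left_mult (0 :: 'r) = 0"
    by (rule endo_eqI) (simp add: app_simps app_left_mult)
  show "left_mult (x - y) = left_mult x - left_mult y"
    by (rule endo_eqI) (simp add: app_simps app_left_mult algebra_simps)
  have "left_mult (- 1 :: 'r) = - 1"
    by (rule endo_eqI) (simp add: app_simps app_left_mult)
  then show "left_mult (ring_sign d e :: 'r) = ring_sign d e"
    by (simp add: ring_sign_def left_mult_hom)
qed

lemma qrow_left_mult:
  assumes "qrow q qi p x1 x2"
  shows "qrow (left_mult q) (left_mult qi) p (left_mult x1) (left_mult x2)"
  using assms by (auto simp: qrow_def left_mult_simps simp flip: left_mult_hom(2))

lemma qcomm_left_mult: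
  assumes "qcomm q qi (ring_sign d e) x1 x2 y1 y2"
  shows "qcomm (left_mult q) (left_mult qi) (ring_sign d e)
    (left_mult x1) (left_mult x2) (left_mult y1) (left_mult y2)"
proof -
  note eqs = assms[unfolded qcomm_def]
  show ?thesis
    unfolding qcomm_def left_mult_simps(3,4)[symmetric] left_mult_hom(1,2)[symmetric]
    using eqs by simp
qed

lemma two_col_left_mult: "L.two_col {1..4} matrix_parity (\<lambda>i j. left_mult (tgen i j))"
  using two_col_tgen by (auto simp: T.two_col_def L.two_col_def intro!: qrow_left_mult qcomm_left_mult)

lemma two_col_mink_op: "L.two_col {1..6} S_row_parity (\<lambda>i j. mink_op (Entry i j))"
proof -
  note ctx = op_A1_E op_A1_A2 op_E_A2 endo_scalar_comm(1-3)
  have cases6: "i = 1 \<or> i = 2 \<or> (i \<noteq> 1 \<and> i \<noteq> 2 \<and> i - 2 \<in> {1..4})" if "i \<in> {1..6}" for i :: nat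
    using that by auto
  have par: "S_row_parity 1 = 0" "S_row_parity 2 = 0" by (simp_all add: S_row_parity_def)
  have par': "S_row_parity i = matrix_parity (i - 2)" if "i \<noteq> 1" "i \<noteq> 2" "i - 2 \<in> {1..4}" for i
    using that by (auto simp: S_row_parity_def matrix_parity_def)
  note row = L.two_colD(1)[OF two_col_left_mult] and pair = L.two_colD(2)[OF two_col_left_mult]
  show ?thesis
    unfolding L.two_col_def
  proof (intro conjI ballI impI)
    fix i :: nat assume "i \<in> {1..6}"
    from cases6[OF this] consider "i = 1" | "i = 2" | "i \<noteq> 1" "i \<noteq> 2" "i - 2 \<in> {1..4}" by blast
    then show "qrow (left_mult (qscal qvar)) (left_mult (qscal qinv)) (S_row_parity i)
        (mink_op (Entry i 1)) (mink_op (Entry i 2))"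
    proof cases
      case 1
      then show ?thesis using par by (simp add: qrow_def)
    next
      case 2
      then show ?thesis using par op_E_A2 by (simp add: qrow_def)
    next
      case 3
      from L.qrow_acts[OF ctx acts_tgen row[OF 3(3)]] show ?thesis
        using 3 par'[OF 3] by simp
    qed
  next
    fix i k :: nat assume i: "i \<in> {1..6}" and k: "k \<in> {1..6}" and ik: "i < k"
    \<comment> \<open>Pairs of rows are of four kinds: the triangular block itself, either of its
      rows with a lower row, and two lower rows.\<close>
    consider "i = 1" "k = 2" | "i = 1" "k \<noteq> 1" "k \<noteq> 2" "k - 2 \<in> {1..4}" | "i = 2" "k \<noteq> 1" "k \<noteq> 2" "k - 2 \<in> {1..4}"
      | "i \<noteq> 1" "i \<noteq> 2" "i - 2 \<in> {1..4}" "k \<noteq> 1" "k \<noteq> 2" "k - 2 \<in> {1..4}" "i - 2 < k - 2"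
    proof -
      have "k \<noteq> 1" "k = 2 \<Longrightarrow> i = 1" "i - 2 \<in> {1..4} \<Longrightarrow> i - 2 < k - 2" using i ik by auto
      with cases6[OF i] cases6[OF k] that show ?thesis by blast
    qed
    then show "qcomm (left_mult (qscal qvar)) (left_mult (qscal qinv)) (ring_sign (S_row_parity i) (S_row_parity k))
        (mink_op (Entry i 1)) (mink_op (Entry i 2)) (mink_op (Entry k 1)) (mink_op (Entry k 2))"
    proof cases
      case 1
      then show ?thesis using par op_A1_E op_A1_A2 by (simp add: qcomm_def ring_sign_0)
    next
      case 2
      with L.qcomm_acts_base(1)[OF ctx acts_tgen[of "k - 2"]] par show ?thesis
        by (simp add: ring_sign_0)
    next
      case 3
      with L.qcomm_acts_base(2)[OF ctx acts_tgen[of "k - 2"]] par show ?thesis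
        by (simp add: ring_sign_0)
    next
      case 4
      from L.qcomm_acts[OF ctx acts_tgen acts_tgen pair[OF 4(3,6,7)]] show ?thesis
        using 4 par'[OF 4(1-3)] par'[OF 4(4-6)] by simp
    qed
  qed
qed

text \<open>In the operator representation a polynomial in the superspace generators becomes left
  multiplication by the class of the same polynomial in the matrix entries, so a relation of the
  superspace is one of the matrix algebra.\<close>

lemma subst_mink_poly_memD:
  assumes f: "f \<in> free_carrier mat_gens" and mem: "subst mink_poly f \<in> S_ideal"
  shows "f \<in> Mq22_ideal"
proof -
  let ?\<iota> = "\<lambda>c. left_mult (qscal c)"
  note ctx = op_A1_E op_A1_A2 op_E_A2 endo_scalar_comm(1-3)
  have minor: "eval ?\<iota> mink_op (minor r s) =
      L.qdet (mink_op (Entry r 1)) (mink_op (Entry r 2)) (mink_op (Entry s 1)) (mink_op (Entry s 2))" for r s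
    by (simp add: minor_def L.qdet_def M.eval_simps)
  have "eval ?\<iota> mink_op r = 0" if "r \<in> S_rels" for r
  proof (cases "r \<in> manin_relations {1..6} {1, 2} S_row_parity (\<lambda>_. 0)")
    case True
    then show ?thesis
      by (intro eval_manin_relations[OF M.falg_hom_axioms two_col_mink_op _ _ _ _ True]) auto
  next
    case False
    with that show ?thesis using op_B_inverse
      by (auto simp: S_rels_def M.eval_simps minor L.qdet_def mult.assoc)
  qed
  then have "eval ?\<iota> mink_op (subst mink_poly f) = 0"
    using eval_Idl[OF S_rels_closed M.falg_hom_axioms] mem by blast
  moreover have "eval ?\<iota> mink_op (subst mink_poly f) = eval ?\<iota> (\<lambda>g. left_mult (proj (var g))) f"
  proof (rule eval_subst[OF M.falg_hom_axioms L.falg_hom_axioms f])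
    fix g assume "g \<in> mat_gens"
    then obtain i j where g: "g = Entry i j" "i \<in> {1..4}" "j = 1 \<or> j = 2" by (auto simp: mat_gens_def)
    note D = L.minors_acts[OF ctx acts_tgen[of i] op_B_inverse(1)]
    from g(3) show "eval ?\<iota> mink_op (mink_poly g) = left_mult (proj (var g))"
    proof
      assume "j = 1"
      then show ?thesis using D(1) g by (simp add: M.eval_simps minor)
    next
      assume "j = 2"
      then show ?thesis using D(2) g by (simp add: M.eval_simps minor M.scalar_uminus)
    qed
  qed
  moreover have "left_mult (proj f) = eval ?\<iota> (\<lambda>g. left_mult (proj (var g))) f"
    by (rule L.hom_unique[OF f]) (simp_all add: proj_simps left_mult_hom)
  ultimately have "left_mult (proj f :: mat_ring) = 0" by simp
  \<comment> \<open>Left multiplication is faithful, as seen by applying it to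
    \<open>1\<close>.\<close>
  from arg_cong[OF this, of "\<lambda>h. app h 1"] have "(proj f :: mat_ring) = 0"
    by (simp add: app_left_mult app_simps)
  then show ?thesis using proj_mat_eq_0_iff[OF f] by simp
qed

theorem proposition7p10:
  shows "salgebra_isomorphic Cq_M Mq22_even_columns"
proof -
  let ?p = "gen_parity matrix_parity matrix_parity"
  have shift: "Suc (Suc (i - 2)) = i" if "i \<in> {3..6}" for i :: nat
  proof -
    from that have "3 \<le> i" by simp
    then show ?thesis by simp
  qed
  have "{mink_gen i j | i j. i \<in> {3..6} \<and> j \<in> {1, 2}} =
      (\<lambda>g. presented_class S_gens S_parity S_rels (mink_poly g)) ` mat_gens"
  proof (intro equalityI subsetI)
    fix x assume "x \<in> {mink_gen i j | i j. i \<in> {3..6} \<and> j \<in> {1, 2}}"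
    then obtain i j where ij: "i \<in> {3..6}" "j = 1 \<or> j = 2" "x = mink_gen i j" by auto
    \<comment> \<open>Here \<open>i - 2\<close> undoes the row shift of \<open>mink_poly\<close> and
      \<open>3 - j\<close> exchanges the two columns.\<close>
    then have "x = presented_class S_gens S_parity S_rels (mink_poly (Entry (i - 2) (3 - j)))"
      using shift[of i] by (auto simp: mink_gen_def S_class_def)
    moreover have "Entry (i - 2) (3 - j) \<in> mat_gens" using ij by (auto simp: mat_gens_def)
    ultimately show "x \<in> (\<lambda>g. presented_class S_gens S_parity S_rels (mink_poly g)) ` mat_gens" by blast
  next
    fix x assume "x \<in> (\<lambda>g. presented_class S_gens S_parity S_rels (mink_poly g)) ` mat_gens"
    then obtain g where "g \<in> mat_gens" "x = presented_class S_gens S_parity S_rels (mink_poly g)" by blast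
    then obtain i j where ij: "i \<in> {1..4}" "j = 1 \<or> j = 2"
      "x = presented_class S_gens S_parity S_rels (mink_poly (Entry i j))"
      unfolding mat_gens_def by blast
    then have "x = mink_gen (i + 2) (3 - j)" by (auto simp: mink_gen_def S_class_def)
    moreover have "i + 2 \<in> {3..6}" "3 - j \<in> {1, 2}" using ij by auto
    ultimately show "x \<in> {mink_gen i j | i j. i \<in> {3..6} \<and> j \<in> {1, 2}}" by blast
  qed
  then have M: "Cq_M = sub_salgebra (presented S_gens S_parity S_rels)
      ((\<lambda>g. presented_class S_gens S_parity S_rels (mink_poly g)) ` mat_gens)"
    by (simp add: Cq_M_def Cq_S_def)
  have "{Mq22_class (ent i j) | i j. i \<in> {1..4} \<and> j \<in> {1, 2}} =
      (\<lambda>g. presented_class Mq22_gens ?p Mq22_rels (var g)) ` mat_gens"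
    unfolding mat_gens_def Mq22_class_def by blast
  then have E: "Mq22_even_columns = sub_salgebra (presented Mq22_gens ?p Mq22_rels)
      ((\<lambda>g. presented_class Mq22_gens ?p Mq22_rels (var g)) ` mat_gens)"
    by (simp add: Mq22_even_columns_def Mq22_def)
  show ?thesis
    unfolding M E
  proof (rule sub_salgebra_isomorphicI[where p = ?p])
    fix f assume f: "f \<in> free_carrier mat_gens"
    \<comment> \<open>On the matrix side the generators are variables, so the substitution is the
      identity and the two inclusions of relations proved above remain.\<close>
    have "subst var f = f" using f by (rule subst_ident) simp
    then show "subst mink_poly f \<in> S_ideal \<longleftrightarrow> subst var f \<in> Mq22_ideal"
      using subst_mink_poly_mem[OF f] subst_mink_poly_memD[OF f] by auto
  qed (use mat_gens_subset in \<open>auto simp: S_rels_closed S_stable Mq22_rels_closed Mq22_stable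
      mink_poly_closed parity_aut_mink_poly parity_aut_simps(6)\<close>)
qed

end
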